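(* Let $N$ be a net, let $\sigma,\rho\in \mathrm{FS}^\infty(N)$ and let $P,Q$ be GR-processes of $N$ such that $\sigma\in\mathrm{Lin}(P)$ and $\rho\in\mathrm{Lin}(Q)$. Then $\sigma\sqsubseteq_0^\infty\rho$ if and only if $P\sqsubseteq_1^\infty Q$.
   Context: Multisets over a set $X$ are functions $X\to\mathbb{N}$; $A\subseteq B$ means $A(x)\le B(x)$ for all $x$; $+$ and $-$ are pointwise, with $(A-B)(x)=\max(A(x)-B(x),0)$. A net is $N=(S,T,F,M_0)$ with $S,T$ disjoint sets of places and transitions, $F:(S\times T)\cup(T\times S)\to\mathbb{N}$ and $M_0:S\to\mathbb{N}$, such that for every $t\in T$ the set $\{s\mid F(s,t)>0\}$ is finite and non-empty and $\{s\mid F(t,s)>0\}$ is finite. For $x\in S\cup T$, ${}^\bullet x(y)=F(y,x)$ and $x^\bullet(y)=F(x,y)$; for a finite multiset $G$ of transitions ${}^\bullet G=\sum_t G(t)\cdot{}^\bullet t$ and $G^\bullet=\sum_t G(t)\cdot t^\bullet$. For markings $M,M':S\to\mathbb{N}$ and a finite non-empty multiset $G$ of transitions, $M\xrightarrow{G}M'$ iff ${}^\bullet G\subseteq M$ and $M'=(M-{}^\bullet G)+G^\bullet$. For a finite word $t_1\cdots t_n$ or infinite word $t_1t_2\cdots$ over $T$, $M\xrightarrow{\sigma}$ means there are markings with $M\xrightarrow{\{t_1\}}M_1\xrightarrow{\{t_2\}}M_2\cdots$. $\mathrm{FS}^\infty(N)$ is the set of (finite or infinite) words $\sigma$ with $M_0\xrightarrow{\sigma}$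 (firing sequences), $\mathrm{FS}(N)$ the finite ones; $\sigma\le\rho$ means $\sigma$ is a prefix of $\rho$. Two firing sequences are adjacent, $\sigma\equiv_0\rho$, iff $\sigma=\sigma_1tu\sigma_2$, $\rho=\sigma_1ut\sigma_2$ and $M_0\xrightarrow{\sigma_1}M\xrightarrow{\{t,u\}}$ for some $M$; $\equiv_0^*$ is its reflexive transitive closure (on firing sequences). For $\sigma,\rho\in\mathrm{FS}^\infty(N)$: $\sigma\sqsubseteq_0^\infty\rho$ iff for every $\sigma''\in\mathrm{FS}(N)$ with $\sigma''\le\sigma$ there are $\sigma',\rho'\in\mathrm{FS}(N)$ with $\sigma''\le\sigma'\equiv_0^*\rho'\le\rho$. A GR-process of $N$ is a pair $P=(\mathcal N,\pi)$ where $\mathcal N=(\mathcal S,\mathcal T,\mathcal F,\mathcal M_0)$ is a net such that every place $s$ has $|{}^\bullet s|\le1$ and $|s^\bullet|\le1$, $\mathcal M_0(s)=1$ if ${}^\bullet s=\emptyset$ and $0$ otherwise; the relation $\mathcal F^+$ (transitive closure of $\{(x,y)\mid\mathcal F(x,y)>0\}$) is irreflexive; and $\{t\in\mathcal T\mid (t,u)\in\mathcal F^+\}$ is finite for every $u\in\mathcal T$; and $\pi:\mathcal S\cup\mathcal T\to S\cup T$ maps places to places and transitions to transitions with $M_0(s)=|\pi^{-1}(s)\cap\mathcal M_0|$ for all $s\in S$ and, for all $t\in\mathcal T$, $s\in S$: $F(s,\pi(t))=|\pi^{-1}(s)\cap{}^\bullet t|$ and $F(\pi(t),s)=|\pi^{-1}(s)\cap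 t^\bullet|$. $P$ is finite if $\mathcal T$ is finite. $P'=((\mathcal S',\mathcal T',\mathcal F',\mathcal M_0'),\pi')\le P$ (prefix) iff $\mathcal S'\subseteq\mathcal S$, $\mathcal T'\subseteq\mathcal T$, $\mathcal M_0'=\mathcal M_0$, $\mathcal F'$ is the restriction of $\mathcal F$ to $\mathcal S'\times\mathcal T'\cup\mathcal T'\times\mathcal S'$ and $\pi'$ the restriction of $\pi$. Processes $P,Q$ are isomorphic if there is a bijection $\phi$ between their places and transitions preserving initial marking, flow and with $\pi_P=\pi_Q\circ\phi$. For places $p,q$ of $P$ with $(p,q)\notin\mathcal F^+\cup(\mathcal F^+)^{-1}$ and $\pi(p)=\pi(q)$, $\mathrm{swap}(P,p,q)$ is $P$ with flow changed to $\mathcal F'(p,y)=\mathcal F(q,y)$, $\mathcal F'(q,y)=\mathcal F(p,y)$ for $y\in\mathcal T$, and $\mathcal F'(x,y)=\mathcal F(x,y)$ otherwise. $P\equiv_1 Q$ iff $\mathrm{swap}(P,p,q)$ is isomorphic to $Q$ for some $p,q$; $\equiv_1^*$ is its reflexive transitive closure. $P\sqsubseteq_1^\infty Q$ iff for every finite GR-process $P''\le P$ there are finite GR-processes $P',Q'$ with $P''\le P'\equiv_1^*Q'\le Q$. A GR-process $P$ with transitions $\mathcal T$ and $\sigma=t_0t_1t_2\cdots\in\mathrm{FS}^\infty(N)$ are compatible iff there is a bijection $\mathrm{pos}:\mathcal T\to I$ (where $I=\{0,\dots,|\sigma|-1\}$ if $\sigma$ is finite and $I=\mathbb N$ otherwise)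 with $\pi(t)=t_{\mathrm{pos}(t)}$ for all $t$ and $(t,t')\in\mathcal F^+\Rightarrow\mathrm{pos}(t)<\mathrm{pos}(t')$. $\mathrm{Lin}(P)$ is the set of firing sequences compatible with $P$. *)

theory Defs
  imports Main "HOL-Library.Multiset" "HOL-Library.Sublist" "HOL-Library.Extended_Nat"
begin

text \<open>Possibly infinite multisets over a set \<open>X\<close> are functions into \<open>nat\<close> that vanish outside
  \<open>X\<close>; inclusion is the pointwise order. The type \<open>'a multiset\<close> is used only for the finite
  multisets of transitions that fire in one step.\<close>

definition msize :: "('a \<Rightarrow> nat) \<Rightarrow> enat" where
  "msize A = (if finite {x. A x > 0} then enat (\<Sum>x | A x > 0. A x) else \<infinity>)"

record 'a net =
  places :: "'a set"
  transitions :: "'a set"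
  flow :: "'a \<Rightarrow> 'a \<Rightarrow> nat"
  init :: "'a \<Rightarrow> nat"

text \<open>\<open>flow\<close> and \<open>init\<close> are total, so a net must have them equal to 0 outside their
  mathematical domains.\<close>

definition is_net :: "'a net \<Rightarrow> bool" where
  "is_net N \<longleftrightarrow>
     places N \<inter> transitions N = {} \<and>
     (\<forall>x y. flow N x y > 0 \<longrightarrow>
        (x, y) \<in> places N \<times> transitions N \<union> transitions N \<times> places N) \<and>
     (\<forall>x. init N x > 0 \<longrightarrow> x \<in> places N) \<and>
     (\<forall>t \<in> transitions N.
        finite {s \<in> places N. flow N s t > 0} \<and> {s \<in> places N. flow N s t > 0} \<noteq> {} \<and>
        finite {s \<in> places N. flow N t s > 0})"

definition pre :: "'a net \<Rightarrow> 'a \<Rightarrow> 'a \<Rightarrow> nat" where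
  "pre N x = (\<lambda>y. flow N y x)"

definition post :: "'a net \<Rightarrow> 'a \<Rightarrow> 'a \<Rightarrow> nat" where
  "post N x = (\<lambda>y. flow N x y)"

definition pre_mset :: "'a net \<Rightarrow> 'a multiset \<Rightarrow> 'a \<Rightarrow> nat" where
  "pre_mset N G = (\<lambda>s. \<Sum>t\<in>#G. pre N t s)"

definition post_mset :: "'a net \<Rightarrow> 'a multiset \<Rightarrow> 'a \<Rightarrow> nat" where
  "post_mset N G = (\<lambda>s. \<Sum>t\<in>#G. post N t s)"


section \<open>Firing sequences\<close>

definition step :: "'a net \<Rightarrow> ('a \<Rightarrow> nat) \<Rightarrow> 'a multiset \<Rightarrow> ('a \<Rightarrow> nat) \<Rightarrow> bool" where
  "step N M G M' \<longleftrightarrow>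
     G \<noteq> {#} \<and> set_mset G \<subseteq> transitions N \<and>
     pre_mset N G \<le> M \<and> M' = (\<lambda>s. (M s - pre_mset N G s) + post_mset N G s)"

fun fires :: "'a net \<Rightarrow> ('a \<Rightarrow> nat) \<Rightarrow> 'a list \<Rightarrow> ('a \<Rightarrow> nat) \<Rightarrow> bool" where
  "fires N M [] M' \<longleftrightarrow> M' = M"
| "fires N M (t # ts) M' \<longleftrightarrow> (\<exists>M1. step N M {#t#} M1 \<and> fires N M1 ts M')"

datatype 'a word = Fin "'a list" | Inf "nat \<Rightarrow> 'a"

fun word_dom :: "'a word \<Rightarrow> nat set" where
  "word_dom (Fin ts) = {..<length ts}"
| "word_dom (Inf f) = UNIV"

fun word_nth :: "'a word \<Rightarrow> nat \<Rightarrow> 'a" where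
  "word_nth (Fin ts) i = ts ! i"
| "word_nth (Inf f) i = f i"

fun prefix_word :: "'a list \<Rightarrow> 'a word \<Rightarrow> bool" where
  "prefix_word xs (Fin ys) \<longleftrightarrow> prefix xs ys"
| "prefix_word xs (Inf f) \<longleftrightarrow> xs = map f [0..<length xs]"

definition FS :: "'a net \<Rightarrow> 'a list set" where
  "FS N = {ts. \<exists>M'. fires N (init N) ts M'}"

definition FS_inf :: "'a net \<Rightarrow> 'a word set" where
  "FS_inf N = Fin ` FS N \<union>
     {Inf f | f. \<exists>Ms. Ms 0 = init N \<and> (\<forall>i. step N (Ms i) {#f i#} (Ms (Suc i)))}"

definition adj0 :: "'a net \<Rightarrow> 'a list \<Rightarrow> 'a list \<Rightarrow> bool" where
  "adj0 N \<sigma> \<rho> \<longleftrightarrow> \<sigma> \<in> FS N \<and> \<rho> \<in> FS N \<and>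
     (\<exists>\<sigma>1 \<sigma>2 t u M M'. \<sigma> = \<sigma>1 @ [t, u] @ \<sigma>2 \<and> \<rho> = \<sigma>1 @ [u, t] @ \<sigma>2 \<and>
        fires N (init N) \<sigma>1 M \<and> step N M {#t, u#} M')"

definition sqsub0 :: "'a net \<Rightarrow> 'a word \<Rightarrow> 'a word \<Rightarrow> bool" where
  "sqsub0 N \<sigma> \<rho> \<longleftrightarrow>
     (\<forall>\<sigma>'' \<in> FS N. prefix_word \<sigma>'' \<sigma> \<longrightarrow>
        (\<exists>\<sigma>' \<in> FS N. \<exists>\<rho>' \<in> FS N.
           prefix \<sigma>'' \<sigma>' \<and> (adj0 N)\<^sup>*\<^sup>* \<sigma>' \<rho>' \<and> prefix_word \<rho>' \<rho>))"


section \<open>GR-processes\<close>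

definition arcs :: "'a net \<Rightarrow> ('a \<times> 'a) set" where
  "arcs N = {(x, y). flow N x y > 0}"

definition is_causal_net :: "'b net \<Rightarrow> bool" where
  "is_causal_net K \<longleftrightarrow> is_net K \<and>
     (\<forall>s \<in> places K. msize (pre K s) \<le> 1 \<and> msize (post K s) \<le> 1 \<and>
        init K s = (if pre K s = (\<lambda>_. 0) then 1 else 0)) \<and>
     irrefl ((arcs K)\<^sup>+) \<and>
     (\<forall>u \<in> transitions K. finite {t \<in> transitions K. (t, u) \<in> (arcs K)\<^sup>+})"

text \<open>In \<open>('b, 'a) process\<close>, \<open>'b\<close> contains the elements of the causal net and \<open>'a\<close> those of the
  net it unfolds. Values of \<open>lab\<close> outside the causal net are irrelevant.\<close>

record ('b, 'a) process =
  cnet :: "'b net"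
  lab :: "'b \<Rightarrow> 'a"

definition elems :: "('b, 'a) process \<Rightarrow> 'b set" where
  "elems P = places (cnet P) \<union> transitions (cnet P)"

text \<open>The multiset \<open>A\<close> intersected with the preimage of the place \<open>s\<close> under the labelling.\<close>

definition fibre :: "('b, 'a) process \<Rightarrow> 'a \<Rightarrow> ('b \<Rightarrow> nat) \<Rightarrow> 'b \<Rightarrow> nat" where
  "fibre P s A = (\<lambda>x. if x \<in> elems P \<and> lab P x = s then A x else 0)"

definition gr_process :: "'a net \<Rightarrow> ('b, 'a) process \<Rightarrow> bool" where
  "gr_process N P \<longleftrightarrow> is_causal_net (cnet P) \<and>
     lab P ` places (cnet P) \<subseteq> places N \<and>
     lab P ` transitions (cnet P) \<subseteq> transitions N \<and>
     (\<forall>s \<in> places N. enat (init N s) = msize (fibre P s (init (cnet P)))) \<and>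
     (\<forall>t \<in> transitions (cnet P). \<forall>s \<in> places N.
        enat (flow N s (lab P t)) = msize (fibre P s (pre (cnet P) t)) \<and>
        enat (flow N (lab P t) s) = msize (fibre P s (post (cnet P) t)))"

definition finite_gr_process :: "'a net \<Rightarrow> ('b, 'a) process \<Rightarrow> bool" where
  "finite_gr_process N P \<longleftrightarrow> gr_process N P \<and> finite (transitions (cnet P))"

definition process_prefix :: "('b, 'a) process \<Rightarrow> ('b, 'a) process \<Rightarrow> bool" where
  "process_prefix P' P \<longleftrightarrow>
     places (cnet P') \<subseteq> places (cnet P) \<and>
     transitions (cnet P') \<subseteq> transitions (cnet P) \<and>
     init (cnet P') = init (cnet P) \<and>
     (\<forall>(x, y) \<in> places (cnet P') \<times> transitions (cnet P') \<union>
                transitions (cnet P') \<times> places (cnet P').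
        flow (cnet P') x y = flow (cnet P) x y) \<and>
     (\<forall>x \<in> elems P'. lab P' x = lab P x)"

definition isomorphic :: "('b, 'a) process \<Rightarrow> ('b, 'a) process \<Rightarrow> bool" where
  "isomorphic P Q \<longleftrightarrow>
     (\<exists>\<phi>. bij_betw \<phi> (elems P) (elems Q) \<and>
        \<phi> ` places (cnet P) = places (cnet Q) \<and>
        \<phi> ` transitions (cnet P) = transitions (cnet Q) \<and>
        (\<forall>s \<in> places (cnet P). init (cnet Q) (\<phi> s) = init (cnet P) s) \<and>
        (\<forall>x \<in> elems P. \<forall>y \<in> elems P. flow (cnet Q) (\<phi> x) (\<phi> y) = flow (cnet P) x y) \<and>
        (\<forall>x \<in> elems P. lab P x = lab Q (\<phi> x)))"

definition swap :: "('b, 'a) process \<Rightarrow> 'b \<Rightarrow> 'b \<Rightarrow> ('b, 'a) process" where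
  "swap P p q = P\<lparr>cnet := (cnet P)\<lparr>flow := (\<lambda>x y.
     if x = p \<and> y \<in> transitions (cnet P) then flow (cnet P) q y
     else if x = q \<and> y \<in> transitions (cnet P) then flow (cnet P) p y
     else flow (cnet P) x y)\<rparr>\<rparr>"

definition equiv1 :: "'a net \<Rightarrow> ('b, 'a) process \<Rightarrow> ('b, 'a) process \<Rightarrow> bool" where
  "equiv1 N P Q \<longleftrightarrow> gr_process N P \<and> gr_process N Q \<and>
     (\<exists>p \<in> places (cnet P). \<exists>q \<in> places (cnet P).
        (p, q) \<notin> (arcs (cnet P))\<^sup>+ \<union> ((arcs (cnet P))\<^sup>+)\<inverse> \<and> lab P p = lab P q \<and>
        isomorphic (swap P p q) Q)"

text \<open>An extension of a prefix of \<open>P\<close> may need elements that the type \<open>'b\<close> does not have, for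
  instance if \<open>'b\<close> is finite. Therefore \<open>P\<close> and \<open>Q\<close> are first copied into \<open>'b + nat\<close>, which
  always leaves infinitely many elements unused. As a finite process extending another one has
  only finitely many additional elements, this covers all extensions up to isomorphism.\<close>

definition lift :: "('b, 'a) process \<Rightarrow> ('b + nat, 'a) process" where
  "lift P = \<lparr>
     cnet = \<lparr>
       places = Inl ` places (cnet P),
       transitions = Inl ` transitions (cnet P),
       flow = (\<lambda>x y. case (x, y) of (Inl a, Inl b) \<Rightarrow> flow (cnet P) a b | _ \<Rightarrow> 0),
       init = (\<lambda>x. case x of Inl a \<Rightarrow> init (cnet P) a | Inr _ \<Rightarrow> 0)\<rparr>,
     lab = (\<lambda>x. case x of Inl a \<Rightarrow> lab P a | Inr _ \<Rightarrow> undefined)\<rparr>"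

definition sqsub1 :: "'a net \<Rightarrow> ('b, 'a) process \<Rightarrow> ('b, 'a) process \<Rightarrow> bool" where
  "sqsub1 N P Q \<longleftrightarrow>
     (\<forall>P'' :: ('b + nat, 'a) process.
        finite_gr_process N P'' \<and> process_prefix P'' (lift P) \<longrightarrow>
        (\<exists>P' Q'. finite_gr_process N P' \<and> finite_gr_process N Q' \<and>
           process_prefix P'' P' \<and> (equiv1 N)\<^sup>*\<^sup>* P' Q' \<and> process_prefix Q' (lift Q)))"

definition compatible :: "('b, 'a) process \<Rightarrow> 'a word \<Rightarrow> bool" where
  "compatible P \<sigma> \<longleftrightarrow>
     (\<exists>pos. bij_betw pos (transitions (cnet P)) (word_dom \<sigma>) \<and>
        (\<forall>t \<in> transitions (cnet P). lab P t = word_nth \<sigma> (pos t)) \<and>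
        (\<forall>t \<in> transitions (cnet P). \<forall>t' \<in> transitions (cnet P).
           (t, t') \<in> (arcs (cnet P))\<^sup>+ \<longrightarrow> pos t < pos t'))"

definition Lin :: "'a net \<Rightarrow> ('b, 'a) process \<Rightarrow> 'a word set" where
  "Lin N P = {\<sigma> \<in> FS_inf N. compatible P \<sigma>}"

end

theory Submission
  imports Defs
begin

text \<open>A process is described by the producer and the consumer of each of its places. Swapping two
  places exchanges their consumers, so a process can be changed into any other one with the same
  places, transitions and producers and a common linearisation: go along the linearisation and
  give each transition the right tokens. Hence linearising a process and unfolding a firing
  sequence are inverse to each other up to the two equivalences: linearisations of one process
  are related by adjacent transpositions, a transposition of concurrently enabled transitions is
  matched by swaps that make the two transitions causally independent, and a process has a common
  linearisation with each of its swaps. The infinite case follows because each finite prefix of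
  a process lies in the prefix generated by a long enough initial part of the word, and prefixes
  can be extended by firing further transitions.\<close>

section \<open>Topologically sorted lists\<close>

text \<open>A swap of \<open>p\<close> and \<open>q\<close> is allowed only if they are causally
  unordered, and it alters the causal order itself. One criterion settles both problems: an exchange
  of consumers is legitimate as soon as a single list linearises the process before and after it.
  Acyclicity and independence thus reduce to comparing positions in a list, and only immediate
  causality between transitions has to be examined. The number of places with a given label and
  producer is determined by the labels, so two processes with the same word can be matched except
  for their consumers. This is why producers stay fixed and only consumers are corrected. Two
  obstacles shape the final argument. A finite prefix of a process need not spell an initial part of
  the chosen word, so it is enlarged to a prefix generated by such a part; the transitions missing
  at the end of a chain of swaps are carried along as a common suffix. And \<open>equiv1\<close>
  demands a place to swap even where processes are merely renamed, so processes without places are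
  treated separately.\<close>

definition lin :: "('c \<Rightarrow> 'c \<Rightarrow> bool) \<Rightarrow> 'c list \<Rightarrow> bool" where
  "lin R ts \<longleftrightarrow> distinct ts \<and> (\<forall>xs u ys t. ts = xs @ u # ys \<longrightarrow> R t u \<longrightarrow> t \<in> set xs)"

lemma lin_Nil [simp]: "lin R []"
  by (simp add: lin_def)

text \<open>An entry may be appended once all its predecessors are listed. So \<open>lin\<close>
  does more than order: every initial part is closed under predecessors, as the transitions of a
  prefix of a process must be.\<close>

lemma lin_snoc [simp]:
  "lin R (ts @ [u]) \<longleftrightarrow> lin R ts \<and> u \<notin> set ts \<and> (\<forall>t. R t u \<longrightarrow> t \<in> set ts)"
proof
  assume L: "lin R (ts @ [u])"
  have "t \<in> set xs" if "ts = xs @ v # ys" "R t v" for xs v ys t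
    using L that unfolding lin_def by (metis append.assoc append_Cons)
  then show "lin R ts \<and> u \<notin> set ts \<and> (\<forall>t. R t u \<longrightarrow> t \<in> set ts)"
    using L unfolding lin_def by auto
next
  assume L: "lin R ts \<and> u \<notin> set ts \<and> (\<forall>t. R t u \<longrightarrow> t \<in> set ts)"
  have "t \<in> set xs" if "ts @ [u] = xs @ v # ys" "R t v" for xs v ys t
  proof (cases ys rule: rev_cases)
    case Nil
    then show ?thesis using that L by auto
  next
    case (snoc zs z)
    then have "ts = xs @ v # zs" using that by simp
    then show ?thesis using that L unfolding lin_def by blast
  qed
  then show "lin R (ts @ [u])"
    using L unfolding lin_def by auto
qed

lemma lin_distinct: "lin R ts \<Longrightarrow> distinct ts"
  by (simp add: lin_def)

lemma lin_append1: "lin R (xs @ ys) \<Longrightarrow> lin R xs"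
  by (induction ys rule: rev_induct) (auto simp flip: append_assoc)

lemma lin_closed: "lin R ts \<Longrightarrow> R t u \<Longrightarrow> u \<in> set ts \<Longrightarrow> t \<in> set ts"
  by (induction ts rule: rev_induct) auto

lemma lin_mono:
  assumes "lin R ts" "\<And>t u. u \<in> set ts \<Longrightarrow> R' t u \<Longrightarrow> R t u"
  shows "lin R' ts"
  using assms by (induction ts rule: rev_induct) auto

text \<open>Only \<open>b\<close> loses an earlier entry, namely \<open>a\<close>, and
  \<open>\<not> R a b\<close> says that \<open>b\<close> does not require it.\<close>

lemma lin_transpose:
  assumes "lin R (xs @ [a, b] @ ys)" "\<not> R a b"
  shows "lin R (xs @ [b, a] @ ys)"
  using assms
proof (induction ys rule: rev_induct)
  case Nil
  have "lin R ((xs @ [a]) @ [b])" using Nil by simp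
  then have "lin R ((xs @ [b]) @ [a])" using Nil(2) by (simp only: lin_snoc) auto
  then show ?case by simp
next
  case (snoc y ys)
  have "lin R ((xs @ [a, b] @ ys) @ [y])" using snoc.prems by simp
  then have "lin R ((xs @ [b, a] @ ys) @ [y])"
    using snoc.IH snoc.prems(2) by (simp only: lin_snoc) auto
  then show ?case by simp
qed

text \<open>Greedy completion: a minimal missing element of \<open>X\<close> has no missing
  predecessor, and by \<open>closed\<close> its predecessors lie in \<open>X\<close>, hence in the
  list.\<close>

lemma lin_extend:
  assumes fin: "finite X" and wf: "wf {(t, u). R t u}"
    and closed: "\<And>t u. R t u \<Longrightarrow> u \<in> X \<Longrightarrow> t \<in> X"
    and "lin R ts" "set ts \<subseteq> X"
  shows "\<exists>us. lin R (ts @ us) \<and> set (ts @ us) = X"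
  using assms(4,5)
proof (induction "card (X - set ts)" arbitrary: ts)
  case 0
  then have "set ts = X" using fin by auto
  then show ?case using 0 by (intro exI[of _ "[]"]) auto
next
  case (Suc n)
  have "X - set ts \<noteq> {}" using Suc.hyps(2) by (metis card.empty nat.distinct(1))
  then obtain x where "x \<in> X - set ts" by blast
  with wf obtain u where u: "u \<in> X - set ts" "\<And>t. R t u \<Longrightarrow> t \<notin> X - set ts"
    unfolding wf_eq_minimal by (metis (mono_tags, lifting) case_prod_conv mem_Collect_eq)
  have "lin R (ts @ [u])" using u closed Suc.prems by auto
  moreover have "n = card (X - set (ts @ [u]))"
  proof -
    have "X - set (ts @ [u]) = (X - set ts) - {u}" by auto
    then show ?thesis using Suc.hyps(2) u(1) fin by simp
  qed
  ultimately obtain us where "lin R ((ts @ [u]) @ us)" "set ((ts @ [u]) @ us) = X"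
    using Suc.hyps(1)[of "ts @ [u]"] Suc.prems u(1) by auto
  then show ?case by (intro exI[of _ "u # us"]) simp
qed

definition ranks :: "('c \<Rightarrow> nat) \<Rightarrow> 'c list \<Rightarrow> bool" where
  "ranks pos ts \<longleftrightarrow> (\<forall>i < length ts. pos (ts ! i) = i)"

lemma ranks_exists:
  assumes "distinct ts"
  shows "\<exists>pos. ranks pos ts"
proof -
  have "inj_on ((!) ts) {..<length ts}"
    using assms by (simp add: inj_on_nth)
  then have "ranks (inv_into {..<length ts} ((!) ts)) ts"
    unfolding ranks_def by simp
  then show ?thesis by blast
qed

lemma ranks_inj: "ranks pos ts \<Longrightarrow> inj_on pos (set ts)"
  by (auto simp: ranks_def inj_on_def in_set_conv_nth)

lemma ranks_less:
  assumes "ranks pos (xs @ ys)" "t \<in> set xs" "u \<in> set ys"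
  shows "pos t < pos u"
proof -
  obtain i where i: "i < length xs" "xs ! i = t" using assms(2) by (auto simp: in_set_conv_nth)
  obtain j where j: "j < length ys" "ys ! j = u" using assms(3) by (auto simp: in_set_conv_nth)
  have "pos t = i" using assms(1) i unfolding ranks_def
    by (metis length_append nth_append trans_less_add1)
  moreover have "pos u = length xs + j" using assms(1) j unfolding ranks_def
    by (metis length_append nat_add_left_cancel_less nth_append_length_plus)
  ultimately show ?thesis using i by simp
qed

text \<open>Lets one list be tested against several relations: with \<open>R\<close> confined to the
  list, being sorted is monotonicity of one fixed \<open>pos\<close>, which can be checked link by
  link after a swap.\<close>

lemma lin_iff_ranks:
  assumes "distinct ts" "ranks pos ts" "\<And>t u. R t u \<Longrightarrow> t \<in> set ts \<and> u \<in> set ts"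
  shows "lin R ts \<longleftrightarrow> (\<forall>t u. R t u \<longrightarrow> pos t < pos u)"
proof
  assume L: "lin R ts"
  show "\<forall>t u. R t u \<longrightarrow> pos t < pos u"
  proof (intro allI impI)
    fix t u assume R: "R t u"
    then obtain xs ys where ts: "ts = xs @ u # ys" using assms(3) by (meson split_list)
    then have "t \<in> set xs" using L R unfolding lin_def by blast
    then show "pos t < pos u" using ranks_less[of pos xs "u # ys"] assms(2) ts by simp
  qed
next
  assume L: "\<forall>t u. R t u \<longrightarrow> pos t < pos u"
  have "t \<in> set xs" if "ts = xs @ u # ys" "R t u" for xs u ys t
  proof (rule ccontr)
    assume "t \<notin> set xs"
    then have "t = u \<or> t \<in> set ys" using that assms(3)[OF that(2)] by auto
    then have "pos u \<le> pos t"
      using ranks_less[of pos "xs @ [u]" ys u t] assms(2) that by auto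
    then show False using L that(2) by fastforce
  qed
  then show "lin R ts" using assms(1) unfolding lin_def by blast
qed


section \<open>Firing\<close>

lemma fires_append: "fires N M (xs @ ys) M'' \<longleftrightarrow> (\<exists>M'. fires N M xs M' \<and> fires N M' ys M'')"
  by (induction xs arbitrary: M) auto

lemma step_det: "step N M G M1 \<Longrightarrow> step N M G M2 \<Longrightarrow> M1 = M2"
  by (simp add: step_def)

lemma fires_det: "fires N M xs M1 \<Longrightarrow> fires N M xs M2 \<Longrightarrow> M1 = M2"
  by (induction xs arbitrary: M) (auto dest: step_det)

text \<open>The state equation, written with sums because subtraction on \<open>nat\<close>
  truncates. It shows that the marking reached depends only on the multiset of transitions
  fired.\<close>

lemma fires_marking:
  assumes "fires N M ts M'"
  shows "M' s + pre_mset N (mset ts) s = M s + post_mset N (mset ts) s"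
  using assms
proof (induction ts arbitrary: M)
  case Nil
  then show ?case by (simp add: pre_mset_def post_mset_def)
next
  case (Cons t ts)
  then obtain M1 where M1: "step N M {#t#} M1" "fires N M1 ts M'" by auto
  have "pre N t s \<le> M s" "M1 s = M s - pre N t s + post N t s"
    using M1(1) by (auto simp: step_def pre_mset_def post_mset_def le_fun_def)
  then show ?case using Cons.IH[OF M1(2)]
    by (simp add: pre_mset_def post_mset_def)
qed

lemma FS_append: "xs @ ys \<in> FS N \<Longrightarrow> xs \<in> FS N"
  by (auto simp: FS_def fires_append)

text \<open>Adjacent words have the same multiset of letters, so they reach the same marking and
  \<open>z\<close> continues both.\<close>

lemma adj0_append:
  assumes "adj0 N x y" "y @ z \<in> FS N"
  shows "adj0 N (x @ z) (y @ z)"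
proof -
  from assms(1) obtain \<sigma>1 \<sigma>2 t u M M' where xy: "x = \<sigma>1 @ [t, u] @ \<sigma>2" "y = \<sigma>1 @ [u, t] @ \<sigma>2"
    "fires N (init N) \<sigma>1 M" "step N M {#t, u#} M'" and "x \<in> FS N" "y \<in> FS N"
    unfolding adj0_def by blast
  then obtain Mx My where M: "fires N (init N) x Mx" "fires N (init N) y My"
    by (auto simp: FS_def)
  have "mset x = mset y" using xy by simp
  then have "Mx = My"
    using fires_marking[OF M(1)] fires_marking[OF M(2)] by (metis add_right_cancel ext)
  moreover obtain M2 where "fires N (init N) (y @ z) M2" using assms(2) by (auto simp: FS_def)
  ultimately have "fires N (init N) (x @ z) M2"
    using M fires_det unfolding fires_append by metis
  then have "x @ z \<in> FS N" by (auto simp: FS_def)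
  moreover have "x @ z = \<sigma>1 @ [t, u] @ (\<sigma>2 @ z)" "y @ z = \<sigma>1 @ [u, t] @ (\<sigma>2 @ z)"
    using xy by simp_all
  ultimately show ?thesis unfolding adj0_def using xy(3,4) assms(2) by blast
qed

lemma adj0_rtranclp_append:
  assumes "(adj0 N)\<^sup>*\<^sup>* x y" "y @ z \<in> FS N"
  shows "(adj0 N)\<^sup>*\<^sup>* (x @ z) (y @ z)"
  using assms(1)
proof (induction rule: converse_rtranclp_induct)
  case base
  show ?case by simp
next
  case (step x1 x2)
  \<comment> \<open>That \<open>z\<close> can be fired is known after \<open>y\<close> only, so it
    is carried backwards: either \<open>x2 = y\<close>, or \<open>x2 @ z\<close> is the left end of
    an adjacency already obtained.\<close>
  have "x2 @ z \<in> FS N"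
    using step.IH assms(2) by (cases rule: converse_rtranclpE) (auto simp: adj0_def)
  then show ?case using adj0_append[OF step.hyps(1)] step.IH by (meson converse_rtranclp_into_rtranclp)
qed

lemma FS_if_adj0_rtranclp:
  assumes "(adj0 N)\<^sup>*\<^sup>* x y" "y \<in> FS N"
  shows "x \<in> FS N"
  using assms by (cases rule: converse_rtranclpE) (auto simp: adj0_def)

section \<open>Processes given by producers and consumers\<close>

lemma msize_indicator:
  "msize (\<lambda>x. if x \<in> A then 1 else 0) = (if finite A then enat (card A) else \<infinity>)"
  unfolding msize_def by simp

lemma enat_eq_msize_indicator:
  "enat n = msize (\<lambda>x. if x \<in> A then 1 else 0) \<longleftrightarrow> finite A \<and> card A = n"
  by (auto simp: msize_indicator)

text \<open>Supplies the optional producer and the optional consumer of a place of a causal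
  net.\<close>

lemma msize_le_1:
  assumes "msize A \<le> 1"
  shows "\<exists>o'. A = (\<lambda>x. if o' = Some x then 1 else 0)"
proof (cases "\<exists>t. A t > 0")
  case False
  then have "A = (\<lambda>x. if None = Some x then 1 else 0)" by auto
  then show ?thesis by blast
next
  case True
  then obtain t where t: "A t > 0" by blast
  let ?S = "{x. A x > 0}"
  have fin: "finite ?S" using assms unfolding msize_def by (auto split: if_splits)
  then have le: "sum A ?S \<le> 1" using assms unfolding msize_def by (simp add: one_enat_def)
  have "sum A ?S = A t + sum A (?S - {t})" using fin t by (simp add: sum.remove)
  then have "A t = 1" "sum A (?S - {t}) = 0" using le t by auto
  then have "\<And>x. x \<noteq> t \<Longrightarrow> A x = 0" using fin by auto
  then have "A = (\<lambda>x. if Some t = Some x then 1 else 0)" using \<open>A t = 1\<close> by auto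
  then show ?thesis by blast
qed

lemma msize_option: "msize (\<lambda>x. if o' = Some x then 1 else 0) \<le> 1"
proof -
  have eq: "(\<lambda>x. if o' = Some x then 1 else (0::nat)) = (\<lambda>x. if x \<in> set_option o' then 1 else 0)"
    by (auto simp: elem_set)
  have "msize (\<lambda>x. if o' = Some x then 1 else 0) = enat (card (set_option o'))"
    unfolding eq msize_indicator by simp
  then show ?thesis by (cases o') (simp_all add: one_enat_def)
qed

text \<open>Normal form of GR-processes. The guards by \<open>S\<close> make the values of
  \<open>pr\<close> and \<open>co\<close> elsewhere immaterial, and a swap becomes a mere update of
  \<open>co\<close>.\<close>

definition process_of :: "'c set \<Rightarrow> 'c set \<Rightarrow> ('c \<Rightarrow> 'c option) \<Rightarrow> ('c \<Rightarrow> 'c option) \<Rightarrow> ('c \<Rightarrow> 'a) \<Rightarrow>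
    ('c, 'a) process" where
  "process_of S T pr co l = \<lparr>cnet = \<lparr>places = S, transitions = T,
     flow = (\<lambda>x y. if (y \<in> S \<and> pr y = Some x) \<or> (x \<in> S \<and> co x = Some y) then 1 else 0),
     init = (\<lambda>p. if p \<in> S \<and> pr p = None then 1 else 0)\<rparr>, lab = l\<rparr>"

lemma process_of_simps [simp]:
  "places (cnet (process_of S T pr co l)) = S"
  "transitions (cnet (process_of S T pr co l)) = T"
  "flow (cnet (process_of S T pr co l)) x y =
     (if (y \<in> S \<and> pr y = Some x) \<or> (x \<in> S \<and> co x = Some y) then 1 else 0)"
  "init (cnet (process_of S T pr co l)) x = (if x \<in> S \<and> pr x = None then 1 else 0)"
  "lab (process_of S T pr co l) = l"
  by (simp_all add: process_of_def)

text \<open>Immediate causality. A list sorted for it is also sorted for its transitive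
  closure.\<close>

definition link :: "'c set \<Rightarrow> ('c \<Rightarrow> 'c option) \<Rightarrow> ('c \<Rightarrow> 'c option) \<Rightarrow> 'c \<Rightarrow> 'c \<Rightarrow> bool" where
  "link S pr co t u \<longleftrightarrow> (\<exists>p \<in> S. pr p = Some t \<and> co p = Some u)"

text \<open>Acyclicity is left out on purpose: it is derived from a list with
  \<open>lin (link S pr co)\<close> when required, so that the locale survives every exchange of
  consumers between equally labelled places. \<open>T\<close> may be infinite, which covers the two
  given processes.\<close>

locale occurrence =
  fixes N :: "'a net" and S T :: "'c set" and pr co :: "'c \<Rightarrow> 'c option" and l :: "'c \<Rightarrow> 'a"
  assumes net: "is_net N"
    and disj: "S \<inter> T = {}"
    and pr_in: "\<And>p t. p \<in> S \<Longrightarrow> pr p = Some t \<Longrightarrow> t \<in> T"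
    and co_in: "\<And>p t. p \<in> S \<Longrightarrow> co p = Some t \<Longrightarrow> t \<in> T"
    and lab_place: "\<And>p. p \<in> S \<Longrightarrow> l p \<in> places N"
    and lab_transition: "\<And>t. t \<in> T \<Longrightarrow> l t \<in> transitions N"
    and init_count: "\<And>s. s \<in> places N \<Longrightarrow>
      finite {p \<in> S. l p = s \<and> pr p = None} \<and> card {p \<in> S. l p = s \<and> pr p = None} = init N s"
    and post_count: "\<And>s t. s \<in> places N \<Longrightarrow> t \<in> T \<Longrightarrow>
      finite {p \<in> S. l p = s \<and> pr p = Some t} \<and>
      card {p \<in> S. l p = s \<and> pr p = Some t} = flow N (l t) s"
    and pre_count: "\<And>s t. s \<in> places N \<Longrightarrow> t \<in> T \<Longrightarrow>
      finite {p \<in> S. l p = s \<and> co p = Some t} \<and>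
      card {p \<in> S. l p = s \<and> co p = Some t} = flow N s (l t)"
begin

lemma empty_fibre: "s \<notin> places N \<Longrightarrow> {p \<in> S. l p = s \<and> A p} = {}"
  using lab_place by auto

lemma flow_nonplace:
  assumes "s \<notin> places N" "t \<in> T"
  shows "flow N (l t) s = 0" "flow N s (l t) = 0"
proof -
  have "l t \<notin> places N"
    using lab_transition[OF assms(2)] net unfolding is_net_def by blast
  moreover have "(x, y) \<in> places N \<times> transitions N \<union> transitions N \<times> places N"
    if "flow N x y > 0" for x y
    using net that unfolding is_net_def by blast
  ultimately show "flow N (l t) s = 0" "flow N s (l t) = 0"
    using assms(1) by (metis UnE mem_Sigma_iff gr0I)+
qed

text \<open>For labels that are not places of \<open>N\<close> both sides vanish. This lemma and the
  next two spare that case distinction later.\<close>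

lemma init_count': "finite {p \<in> S. l p = s \<and> pr p = None}"
  "card {p \<in> S. l p = s \<and> pr p = None} = init N s"
proof -
  have "finite {p \<in> S. l p = s \<and> pr p = None} \<and>
    card {p \<in> S. l p = s \<and> pr p = None} = init N s"
  proof (cases "s \<in> places N")
    case False
    then have "init N s = 0" using net unfolding is_net_def by blast
    then show ?thesis by (simp add: empty_fibre[OF False])
  qed (rule init_count)
  then show "finite {p \<in> S. l p = s \<and> pr p = None}"
    "card {p \<in> S. l p = s \<and> pr p = None} = init N s" by blast+
qed

lemma post_count': 
  assumes "t \<in> T" shows "finite {p \<in> S. l p = s \<and> pr p = Some t}"
  "card {p \<in> S. l p = s \<and> pr p = Some t} = flow N (l t) s"
proof -
  have "finite {p \<in> S. l p = s \<and> pr p = Some t} \<and>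
    card {p \<in> S. l p = s \<and> pr p = Some t} = flow N (l t) s"
  proof (cases "s \<in> places N")
    case True
    then show ?thesis using post_count assms by blast
  next
    case False
    then show ?thesis by (simp add: empty_fibre[OF False] flow_nonplace(1)[OF False assms])
  qed
  then show "finite {p \<in> S. l p = s \<and> pr p = Some t}"
    "card {p \<in> S. l p = s \<and> pr p = Some t} = flow N (l t) s" by blast+
qed

lemma pre_count':
  assumes "t \<in> T" shows "finite {p \<in> S. l p = s \<and> co p = Some t}"
  "card {p \<in> S. l p = s \<and> co p = Some t} = flow N s (l t)"
proof -
  have "finite {p \<in> S. l p = s \<and> co p = Some t} \<and>
    card {p \<in> S. l p = s \<and> co p = Some t} = flow N s (l t)"
  proof (cases "s \<in> places N")
    case True
    then show ?thesis using pre_count assms by blast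
  next
    case False
    then show ?thesis by (simp add: empty_fibre[OF False] flow_nonplace(2)[OF False assms])
  qed
  then show "finite {p \<in> S. l p = s \<and> co p = Some t}"
    "card {p \<in> S. l p = s \<and> co p = Some t} = flow N s (l t)" by blast+
qed

lemma finite_post:
  assumes "t \<in> T" shows "finite {p \<in> S. pr p = Some t}"
proof -
  have "finite {s \<in> places N. flow N (l t) s > 0}"
    using net lab_transition[OF assms] unfolding is_net_def by blast
  moreover have "{p \<in> S. pr p = Some t} \<subseteq>
      (\<Union>s \<in> {s \<in> places N. flow N (l t) s > 0}. {p \<in> S. l p = s \<and> pr p = Some t})"
  proof
    fix p assume p: "p \<in> {p \<in> S. pr p = Some t}"
    then have "flow N (l t) (l p) > 0"
      using post_count'(1)[OF assms, of "l p"]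
      unfolding post_count'(2)[OF assms, of "l p", symmetric] card_gt_0_iff by auto
    then show "p \<in> (\<Union>s \<in> {s \<in> places N. flow N (l t) s > 0}. {p \<in> S. l p = s \<and> pr p = Some t})"
      using p lab_place by auto
  qed
  ultimately show ?thesis using post_count'(1)[OF assms] by (meson finite_UN_I finite_subset)
qed

lemma finite_pre:
  assumes "t \<in> T" shows "finite {p \<in> S. co p = Some t}"
proof -
  have "finite {s \<in> places N. flow N s (l t) > 0}"
    using net lab_transition[OF assms] unfolding is_net_def by blast
  moreover have "{p \<in> S. co p = Some t} \<subseteq>
      (\<Union>s \<in> {s \<in> places N. flow N s (l t) > 0}. {p \<in> S. l p = s \<and> co p = Some t})"
  proof
    fix p assume p: "p \<in> {p \<in> S. co p = Some t}"
    then have "flow N (l p) (l t) > 0"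
      using pre_count'(1)[OF assms, of "l p"]
      unfolding pre_count'(2)[OF assms, of "l p", symmetric] card_gt_0_iff by auto
    then show "p \<in> (\<Union>s \<in> {s \<in> places N. flow N s (l t) > 0}. {p \<in> S. l p = s \<and> co p = Some t})"
      using p lab_place by auto
  qed
  ultimately show ?thesis using pre_count'(1)[OF assms] by (meson finite_UN_I finite_subset)
qed

lemma nonempty_pre:
  assumes "t \<in> T" shows "{p \<in> S. co p = Some t} \<noteq> {}"
proof -
  have "{s \<in> places N. flow N s (l t) > 0} \<noteq> {}"
    using net lab_transition[OF assms] unfolding is_net_def by blast
  then obtain s where "flow N s (l t) > 0" by blast
  then have "{p \<in> S. l p = s \<and> co p = Some t} \<noteq> {}"
    using pre_count'(2)[OF assms, of s] by (metis card.empty less_numeral_extra(3))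
  then show ?thesis by blast
qed

lemma link_in: "link S pr co t u \<Longrightarrow> t \<in> T \<and> u \<in> T"
  unfolding link_def using pr_in co_in by blast

lemma arcs_process_of:
  "arcs (cnet (process_of S T pr co l)) =
     {(t, p). p \<in> S \<and> pr p = Some t} \<union> {(p, t). p \<in> S \<and> co p = Some t}"
  unfolding arcs_def by auto

lemma link_arcs: "link S pr co t u \<Longrightarrow> (t, u) \<in> (arcs (cnet (process_of S T pr co l)))\<^sup>+"
  unfolding link_def arcs_process_of by (auto intro!: trancl_into_trancl[OF r_into_trancl])

text \<open>Height in the causal order, with a place just above its producer.\<close>

definition rank :: "('c \<Rightarrow> nat) \<Rightarrow> 'c \<Rightarrow> nat" where
  "rank pos x = (if x \<in> T then 2 * pos x + 1 else (case pr x of None \<Rightarrow> 0 | Some t \<Rightarrow> 2 * pos t + 2))"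

text \<open>If \<open>t\<close> produces a place and \<open>u\<close> consumes it, then
  \<open>pos u \<ge> pos t + 1\<close>, so \<open>u\<close> has rank at least
  \<open>2 * pos t + 3\<close> and the value \<open>2 * pos t + 2\<close> of the place lies strictly
  between; initial places get 0, below every transition. Thus positions of transitions control all
  paths of the net.\<close>

lemma rank_arcs:
  assumes "\<And>t u. link S pr co t u \<Longrightarrow> pos t < pos u"
    and "(x, y) \<in> (arcs (cnet (process_of S T pr co l)))\<^sup>+"
  shows "rank pos x < rank pos y"
proof -
  have arc: "rank pos x < rank pos y" if xy: "(x, y) \<in> arcs (cnet (process_of S T pr co l))" for x y
  proof -
    consider "y \<in> S" "pr y = Some x" | "x \<in> S" "co x = Some y"
      using xy unfolding arcs_process_of by blast
    then show ?thesis
    proof cases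
      case 1
      then show ?thesis using pr_in[OF 1] disj by (auto simp: rank_def)
    next
      case 2
      then have "y \<in> T" "x \<notin> T" using co_in disj by auto
      moreover have "pos t < pos y" if "pr x = Some t" for t
        using assms(1) 2 that unfolding link_def by blast
      ultimately show ?thesis by (auto simp: rank_def split: option.split)
    qed
  qed
  show ?thesis
    using assms(2) by (induction rule: trancl_induct) (auto dest: arc intro: less_trans)
qed

lemma pre_process_of: 
  assumes "p \<in> S"
  shows "pre (cnet (process_of S T pr co l)) p = (\<lambda>x. if pr p = Some x then 1 else 0)"
  using assms disj co_in unfolding pre_def by fastforce

lemma post_process_of:
  assumes "p \<in> S"
  shows "post (cnet (process_of S T pr co l)) p = (\<lambda>x. if co p = Some x then 1 else 0)"
  using assms disj pr_in unfolding post_def by fastforce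

text \<open>The list contributes irreflexivity of the causal order, through the strictly increasing
  \<open>rank\<close>. The remaining conditions are the counts of the locale, since every fibre is
  an indicator function.\<close>

lemma finite_gr_process_of:
  assumes "finite T" "lin (link S pr co) ts" "set ts = T"
  shows "finite_gr_process N (process_of S T pr co l)"
proof -
  let ?K = "cnet (process_of S T pr co l)"
  obtain pos where pos: "ranks pos ts" using ranks_exists lin_distinct[OF assms(2)] by blast
  have less: "link S pr co t u \<Longrightarrow> pos t < pos u" for t u
    using lin_iff_ranks[OF lin_distinct[OF assms(2)] pos, of "link S pr co"] assms link_in by blast
  have pre0: "{s \<in> places ?K. flow ?K s t > 0} = {p \<in> S. co p = Some t}" if "t \<in> T" for t
    using that disj by auto
  have post0: "{s \<in> places ?K. flow ?K t s > 0} = {p \<in> S. pr p = Some t}" if "t \<in> T" for t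
    using that disj by auto
  have flow0: "flow ?K x y > 0 \<longrightarrow> (x, y) \<in> places ?K \<times> transitions ?K \<union> transitions ?K \<times> places ?K" for x y
    using pr_in co_in by auto
  have "finite {s \<in> places ?K. flow ?K s t > 0} \<and> {s \<in> places ?K. flow ?K s t > 0} \<noteq> {} \<and>
      finite {s \<in> places ?K. flow ?K t s > 0}" if "t \<in> transitions ?K" for t
  proof -
    have "t \<in> T" using that by simp
    then show ?thesis
      unfolding pre0[OF \<open>t \<in> T\<close>] post0[OF \<open>t \<in> T\<close>]
      using finite_pre finite_post nonempty_pre by blast
  qed
  moreover have "places ?K \<inter> transitions ?K = {}" "\<And>x. init ?K x > 0 \<longrightarrow> x \<in> places ?K"
    using disj by simp_all
  ultimately have "is_net ?K"
    unfolding is_net_def using flow0 by blast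
  moreover have "\<forall>s \<in> places ?K. msize (pre ?K s) \<le> 1 \<and> msize (post ?K s) \<le> 1 \<and>
        init ?K s = (if pre ?K s = (\<lambda>_. 0) then 1 else 0)"
  proof -
    have "(pre ?K p = (\<lambda>_. 0)) \<longleftrightarrow> pr p = None" if "p \<in> S" for p
      using pre_process_of[OF that] by (cases "pr p") (auto simp: fun_eq_iff)
    then show ?thesis by (simp add: pre_process_of post_process_of msize_option)
  qed
  moreover have "irrefl ((arcs ?K)\<^sup>+)"
    unfolding irrefl_def using rank_arcs[of pos, OF less] by blast
  ultimately have "is_causal_net ?K"
    using assms(1) unfolding is_causal_net_def by simp
  moreover have "fibre (process_of S T pr co l) s (init ?K) =
      (\<lambda>p. if p \<in> {p \<in> S. l p = s \<and> pr p = None} then 1 else 0)" for s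
    unfolding fibre_def elems_def by auto
  moreover have "fibre (process_of S T pr co l) s (pre ?K t) =
      (\<lambda>p. if p \<in> {p \<in> S. l p = s \<and> co p = Some t} then 1 else 0)" if "t \<in> T" for s t
    using that disj co_in pr_in unfolding fibre_def elems_def pre_def by fastforce
  moreover have "fibre (process_of S T pr co l) s (post ?K t) =
      (\<lambda>p. if p \<in> {p \<in> S. l p = s \<and> pr p = Some t} then 1 else 0)" if "t \<in> T" for s t
    using that disj co_in pr_in unfolding fibre_def elems_def post_def by fastforce
  ultimately show ?thesis
    using lab_place lab_transition init_count pre_count post_count assms(1)
    unfolding finite_gr_process_def gr_process_def
    by (simp add: enat_eq_msize_indicator image_subset_iff del: process_of_simps(3,4) mem_Collect_eq)
qed

end

text \<open>Equality of records, not only isomorphism, is possible because \<open>is_net\<close>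
  makes \<open>flow\<close> and \<open>init\<close> vanish outside their domains.\<close>

lemma gr_process_decompose:
  assumes "is_net N" "gr_process N P"
  obtains pr co where
    "P = process_of (places (cnet P)) (transitions (cnet P)) pr co (lab P)"
    "occurrence N (places (cnet P)) (transitions (cnet P)) pr co (lab P)"
proof -
  let ?K = "cnet P"
  let ?S = "places ?K" and ?T = "transitions ?K" and ?l = "lab P"
  have K: "is_causal_net ?K" and gr: "lab P ` ?S \<subseteq> places N" "lab P ` ?T \<subseteq> transitions N"
     "\<forall>s \<in> places N. enat (init N s) = msize (fibre P s (init ?K))"
     "\<forall>t \<in> ?T. \<forall>s \<in> places N.
        enat (flow N s (?l t)) = msize (fibre P s (pre ?K t)) \<and>
        enat (flow N (?l t) s) = msize (fibre P s (post ?K t))"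
    using assms(2) unfolding gr_process_def by auto
  then have "\<forall>p \<in> ?S. \<exists>o'. pre ?K p = (\<lambda>x. if o' = Some x then 1 else 0)"
    "\<forall>p \<in> ?S. \<exists>o'. post ?K p = (\<lambda>x. if o' = Some x then 1 else 0)"
    unfolding is_causal_net_def using msize_le_1 by blast+
  then obtain pr co where
    pr: "\<And>p. p \<in> ?S \<Longrightarrow> pre ?K p = (\<lambda>x. if pr p = Some x then 1 else 0)" and
    co: "\<And>p. p \<in> ?S \<Longrightarrow> post ?K p = (\<lambda>x. if co p = Some x then 1 else 0)"
    unfolding Bex_def by metis
  have disj: "?S \<inter> ?T = {}" and
    fl: "\<And>x y. flow ?K x y > 0 \<Longrightarrow> (x, y) \<in> ?S \<times> ?T \<union> ?T \<times> ?S"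
    using K unfolding is_causal_net_def is_net_def by auto
  have fpr: "flow ?K x p = (if pr p = Some x then 1 else 0)" if "p \<in> ?S" for x p
    using pr[OF that] unfolding pre_def by meson
  have fco: "flow ?K p x = (if co p = Some x then 1 else 0)" if "p \<in> ?S" for x p
    using co[OF that] unfolding post_def by meson
  have pr_in: "t \<in> ?T" if "p \<in> ?S" "pr p = Some t" for p t
    using fl[of t p] fpr[of p t] that disj by auto
  have co_in: "t \<in> ?T" if "p \<in> ?S" "co p = Some t" for p t
    using fl[of p t] fco[of p t] that disj by auto
  have in0: "init ?K = (\<lambda>p. if p \<in> ?S \<and> pr p = None then 1 else 0)"
  proof
    fix p
    have "init ?K p = 0" if "p \<notin> ?S"
      using K that unfolding is_causal_net_def is_net_def by auto
    moreover have "(pre ?K p = (\<lambda>_. 0)) \<longleftrightarrow> pr p = None" if "p \<in> ?S"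
      using pr[OF that] by (cases "pr p") (auto simp: fun_eq_iff)
    ultimately show "init ?K p = (if p \<in> ?S \<and> pr p = None then 1 else 0)"
      using K unfolding is_causal_net_def by (cases "p \<in> ?S") simp_all
  qed
  have fl_eq: "flow ?K = (\<lambda>x y. if (y \<in> ?S \<and> pr y = Some x) \<or> (x \<in> ?S \<and> co x = Some y) then 1 else 0)"
  proof (intro ext)
    fix x y
    consider "y \<in> ?S" | "y \<notin> ?S" "x \<in> ?S" | "y \<notin> ?S" "x \<notin> ?S" by blast
    then show "flow ?K x y =
        (if (y \<in> ?S \<and> pr y = Some x) \<or> (x \<in> ?S \<and> co x = Some y) then 1 else 0)"
    proof cases
      case 1 then show ?thesis using fpr[of y x] co_in[of x y] disj by auto
    next
      case 2 then show ?thesis using fco[of x y] by auto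
    next
      case 3 then show ?thesis using fl[of x y] by auto
    qed
  qed
  have P: "P = process_of ?S ?T pr co ?l"
    unfolding process_of_def using fl_eq in0 by (cases P; cases "cnet P") auto
  have f1: "fibre P s (init ?K) =
      (\<lambda>p. if p \<in> {p \<in> ?S. ?l p = s \<and> pr p = None} then 1 else 0)" for s
    unfolding fibre_def elems_def in0 by auto
  have f2: "fibre P s (pre ?K t) =
      (\<lambda>p. if p \<in> {p \<in> ?S. ?l p = s \<and> co p = Some t} then 1 else 0)" if "t \<in> ?T" for s t
    using that disj co_in pr_in unfolding fibre_def elems_def pre_def fl_eq by fastforce
  have f3: "fibre P s (post ?K t) =
      (\<lambda>p. if p \<in> {p \<in> ?S. ?l p = s \<and> pr p = Some t} then 1 else 0)" if "t \<in> ?T" for s t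
    using that disj co_in pr_in unfolding fibre_def elems_def post_def fl_eq by fastforce
  have "occurrence N ?S ?T pr co ?l"
  proof
    fix s assume s: "s \<in> places N"
    show "finite {p \<in> ?S. ?l p = s \<and> pr p = None} \<and>
        card {p \<in> ?S. ?l p = s \<and> pr p = None} = init N s"
      using gr(3)[rule_format, OF s] unfolding f1 enat_eq_msize_indicator .
    fix t assume t: "t \<in> ?T"
    show "finite {p \<in> ?S. ?l p = s \<and> pr p = Some t} \<and>
        card {p \<in> ?S. ?l p = s \<and> pr p = Some t} = flow N (?l t) s"
      using gr(4)[rule_format, OF t s] unfolding f2[OF t] f3[OF t] enat_eq_msize_indicator by blast
    show "finite {p \<in> ?S. ?l p = s \<and> co p = Some t} \<and>
        card {p \<in> ?S. ?l p = s \<and> co p = Some t} = flow N s (?l t)"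
      using gr(4)[rule_format, OF t s] unfolding f2[OF t] f3[OF t] enat_eq_msize_indicator by blast
  qed (use assms disj pr_in co_in gr in auto)
  with P that show ?thesis by blast
qed

section \<open>Firing the transitions of a process\<close>

context occurrence
begin

text \<open>For \<open>X\<close> closed under causes, these are the tokens present when exactly the
  transitions of \<open>X\<close> have fired.\<close>

definition cut :: "'c set \<Rightarrow> 'c set" where
  "cut X = {p \<in> S. (\<forall>t. pr p = Some t \<longrightarrow> t \<in> X) \<and> (\<forall>t \<in> X. co p \<noteq> Some t)}"

definition marking :: "'c set \<Rightarrow> 'a \<Rightarrow> nat" where
  "marking X s = card {p \<in> cut X. l p = s}"

lemma finite_cut:
  assumes "finite X" "X \<subseteq> T"
  shows "finite {p \<in> cut X. l p = s}"
proof (rule finite_subset)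
  show "{p \<in> cut X. l p = s} \<subseteq>
      {p \<in> S. l p = s \<and> pr p = None} \<union> (\<Union>t \<in> X. {p \<in> S. l p = s \<and> pr p = Some t})"
    unfolding cut_def by (auto simp: not_None_eq) (metis option.exhaust)
  show "finite ({p \<in> S. l p = s \<and> pr p = None} \<union> (\<Union>t \<in> X. {p \<in> S. l p = s \<and> pr p = Some t}))"
    using init_count'(1) post_count'(1) assms by auto
qed

lemma marking_empty: "marking {} = init N"
proof
  fix s
  have "{p \<in> cut {}. l p = s} = {p \<in> S. l p = s \<and> pr p = None}"
    unfolding cut_def by auto
  then show "marking {} s = init N s" unfolding marking_def by (simp add: init_count'(2))
qed

lemma pre_subset_cut:
  assumes "t \<in> T - X" "\<And>u. link S pr co u t \<Longrightarrow> u \<in> X"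
  shows "{p \<in> S. co p = Some t} \<subseteq> cut X"
  using assms unfolding cut_def link_def by auto

lemma step_marking:
  assumes X: "finite X" "X \<subseteq> T" "\<And>t u. link S pr co t u \<Longrightarrow> u \<in> X \<Longrightarrow> t \<in> X"
    and t: "t \<in> T - X" "\<And>u. link S pr co u t \<Longrightarrow> u \<in> X"
  shows "step N (marking X) {#l t#} (marking (insert t X))"
proof -
  have tT: "t \<in> T" using t by blast
  let ?A = "\<lambda>s. {p \<in> S. l p = s \<and> co p = Some t}"
  let ?B = "\<lambda>s. {p \<in> S. l p = s \<and> pr p = Some t}"
  let ?C = "\<lambda>s. {p \<in> cut X. l p = s}"
  have AC: "?A s \<subseteq> ?C s" for s using pre_subset_cut[of t X] t by auto
  have BC: "?B s \<inter> (?C s - ?A s) = {}" for s using t unfolding cut_def by auto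
  have un: "{p \<in> cut (insert t X). l p = s} = (?C s - ?A s) \<union> ?B s" for s
  proof -
    \<comment> \<open>The tokens produced by \<open>t\<close> are still unconsumed: a consumer in
      \<open>X\<close> would force \<open>t\<close> into \<open>X\<close> by closure, and so would
      \<open>t\<close> consuming its own token.\<close>
    have "co p \<noteq> Some u" if "p \<in> S" "pr p = Some t" "u \<in> insert t X" for p u
      using that t X(3)[of t u] unfolding link_def by auto
    then show ?thesis unfolding cut_def by auto
  qed
  have "marking (insert t X) s = marking X s - card (?A s) + card (?B s)" for s
    unfolding marking_def un
    using finite_cut[OF X(1,2)] post_count'(1)[OF tT] pre_count'(1)[OF tT] BC[of s] AC[of s]
    by (subst card_Un_disjoint) (auto simp: card_Diff_subset)
  moreover have "card (?A s) \<le> marking X s" for s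
    unfolding marking_def using AC finite_cut[OF X(1,2)] by (simp add: card_mono)
  ultimately show ?thesis
    unfolding step_def pre_mset_def post_mset_def
    using pre_count'(2)[OF tT] post_count'(2)[OF tT] lab_transition[OF tT]
    by (auto simp: pre_def post_def le_fun_def)
qed

lemma fires_lin:
  assumes "lin (link S pr co) ts" "set ts \<subseteq> T"
  shows "fires N (init N) (map l ts) (marking (set ts))"
  using assms
proof (induction ts rule: rev_induct)
  case Nil
  then show ?case by (simp add: marking_empty)
next
  case (snoc t ts)
  then have L: "lin (link S pr co) ts" by simp
  have "step N (marking (set ts)) {#l t#} (marking (insert t (set ts)))"
    using snoc.prems lin_closed[OF L] by (intro step_marking) auto
  then show ?case using snoc by (auto simp: fires_append)
qed

lemma FS_lin: "lin (link S pr co) ts \<Longrightarrow> set ts \<subseteq> T \<Longrightarrow> map l ts \<in> FS N"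
  using fires_lin unfolding FS_def by blast

text \<open>Both presets lie in the cut, and they are disjoint because a place has one consumer. So
  the cut meets the joint demand, also when \<open>l a = l b\<close>.\<close>

lemma step_concurrent:
  assumes X: "finite X" "X \<subseteq> T"
    and a: "a \<in> T - X" "\<And>u. link S pr co u a \<Longrightarrow> u \<in> X"
    and b: "b \<in> T - X" "\<And>u. link S pr co u b \<Longrightarrow> u \<in> X"
    and "a \<noteq> b"
  shows "\<exists>M'. step N (marking X) {#l a, l b#} M'"
proof -
  have ab: "a \<in> T" "b \<in> T" using a b by auto
  let ?A = "\<lambda>t s. {p \<in> S. l p = s \<and> co p = Some t}"
  have "flow N s (l a) + flow N s (l b) \<le> marking X s" for s
  proof -
    have "?A a s \<union> ?A b s \<subseteq> {p \<in> cut X. l p = s}"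
      using pre_subset_cut[of a X] pre_subset_cut[of b X] a b by auto
    then have "card (?A a s \<union> ?A b s) \<le> marking X s"
      unfolding marking_def by (rule card_mono[OF finite_cut[OF X]])
    moreover have "card (?A a s \<union> ?A b s) = card (?A a s) + card (?A b s)"
      using pre_count'(1) ab \<open>a \<noteq> b\<close> by (intro card_Un_disjoint) auto
    ultimately show ?thesis using pre_count'(2) ab by simp
  qed
  then show ?thesis
    unfolding step_def pre_mset_def using ab lab_transition
    by (auto simp: le_fun_def pre_def)
qed

text \<open>The given list shows that \<open>a\<close> has all its causes in \<open>xs\<close>, the
  transposed one shows the same for \<open>b\<close>; hence both can fire together after
  \<open>xs\<close>.\<close>

lemma adj0_transpose:
  assumes L: "lin (link S pr co) (xs @ [a, b] @ ys)" and sub: "set (xs @ [a, b] @ ys) \<subseteq> T"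
    and not: "\<not> link S pr co a b"
  shows "adj0 N (map l (xs @ [a, b] @ ys)) (map l (xs @ [b, a] @ ys))"
proof -
  have L': "lin (link S pr co) (xs @ [b, a] @ ys)" using lin_transpose[OF L not] .
  have "lin (link S pr co) (xs @ [a])" "lin (link S pr co) (xs @ [b])"
    using lin_append1[of _ "xs @ [a]" "b # ys"] lin_append1[of _ "xs @ [b]" "a # ys"] L L' by simp_all
  moreover have "a \<noteq> b" using lin_distinct[OF L] by simp
  ultimately have "\<exists>M'. step N (marking (set xs)) {#l a, l b#} M'"
    using sub by (intro step_concurrent) auto
  moreover have "fires N (init N) (map l xs) (marking (set xs))"
    using fires_lin lin_append1[OF L] sub by simp
  moreover have "map l (xs @ [a, b] @ ys) \<in> FS N" "map l (xs @ [b, a] @ ys) \<in> FS N"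
    using FS_lin[OF L] FS_lin[OF L'] sub by auto
  moreover have "map l (xs @ [a, b] @ ys) = map l xs @ [l a, l b] @ map l ys"
    "map l (xs @ [b, a] @ ys) = map l xs @ [l b, l a] @ map l ys" by simp_all
  ultimately show ?thesis unfolding adj0_def by blast
qed

lemma adj0_move_front:
  assumes "lin (link S pr co) (zs @ as @ t # bs)" "set (zs @ as @ t # bs) \<subseteq> T"
    and "\<And>x. x \<in> set as \<Longrightarrow> \<not> link S pr co x t"
  shows "(adj0 N)\<^sup>*\<^sup>* (map l (zs @ as @ t # bs)) (map l (zs @ t # as @ bs)) \<and>
    lin (link S pr co) (zs @ t # as @ bs)"
  using assms
proof (induction as arbitrary: bs rule: rev_induct)
  case Nil
  then show ?case by simp
next
  case (snoc a as)
  let ?x = "(zs @ as) @ [a, t] @ bs" and ?y = "(zs @ as) @ [t, a] @ bs"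
  have L: "lin (link S pr co) ?x" "set ?x \<subseteq> T" "\<not> link S pr co a t" using snoc.prems by auto
  have "adj0 N (map l ?x) (map l ?y)" using adj0_transpose[OF L] .
  moreover have "(adj0 N)\<^sup>*\<^sup>* (map l (zs @ as @ t # (a # bs))) (map l (zs @ t # as @ (a # bs))) \<and>
      lin (link S pr co) (zs @ t # as @ (a # bs))"
    using lin_transpose[OF L(1,3)] snoc.prems by (intro snoc.IH) auto
  ultimately show ?case by (simp add: converse_rtranclp_into_rtranclp)
qed

text \<open>Sorting by adjacent transpositions: the first entry \<open>t\<close> of the target is
  moved forward and joins the settled part \<open>zs\<close>. Its causes all lie in
  \<open>zs\<close>, so no entry passed on the way is one of them.\<close>

lemma adj0_lin:
  assumes "lin (link S pr co) (zs @ xs)" "lin (link S pr co) (zs @ ys)" "set xs = set ys"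
    "set (zs @ xs) \<subseteq> T"
  shows "(adj0 N)\<^sup>*\<^sup>* (map l (zs @ xs)) (map l (zs @ ys))"
  using assms
proof (induction ys arbitrary: zs xs)
  case Nil
  then show ?case by simp
next
  case (Cons t ys)
  then have "t \<in> set xs" by simp
  then obtain as bs where xs: "xs = as @ t # bs" by (meson split_list)
  have "lin (link S pr co) (zs @ [t])"
    using lin_append1[of _ "zs @ [t]" ys] Cons.prems(2) by simp
  then have "\<not> link S pr co x t" if "x \<in> set as" for x
    using that lin_distinct[OF Cons.prems(1)] xs by auto
  then have *: "(adj0 N)\<^sup>*\<^sup>* (map l (zs @ xs)) (map l (zs @ t # as @ bs))"
    "lin (link S pr co) (zs @ t # as @ bs)"
    using adj0_move_front[of zs as t bs] Cons.prems(1,4) xs by auto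
  have "set (as @ bs) = set ys"
    using Cons.prems(3) lin_distinct[OF Cons.prems(1)] lin_distinct[OF Cons.prems(2)] xs by auto
  then have "(adj0 N)\<^sup>*\<^sup>* (map l ((zs @ [t]) @ as @ bs)) (map l ((zs @ [t]) @ ys))"
    using * Cons.prems(2,4) xs by (intro Cons.IH) auto
  with *(1) show ?case by simp
qed


subsection \<open>Swapping\<close>

lemma swap_process_of:
  assumes "p \<in> S" "q \<in> S"
  shows "swap (process_of S T pr co l) p q = process_of S T pr (co(p := co q, q := co p)) l"
proof -
  have "p \<notin> T" "q \<notin> T" using assms disj by auto
  then have "flow (cnet (swap (process_of S T pr co l) p q)) x y =
    flow (cnet (process_of S T pr (co(p := co q, q := co p)) l)) x y" for x y
    using assms disj pr_in co_in unfolding swap_def by auto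
  then show ?thesis unfolding swap_def process_of_def by (simp add: fun_eq_iff)
qed

text \<open>Exchanging \<open>p\<close> and \<open>q\<close> maps the old preset of each transition
  bijectively to the new one and preserves labels.\<close>

lemma occurrence_swap:
  assumes "p \<in> S" "q \<in> S" "l p = l q"
  shows "occurrence N S T pr (co(p := co q, q := co p)) l"
proof
  fix s t assume st: "s \<in> places N" "t \<in> T"
  let ?f = "id(p := q, q := p)" and ?co = "co(p := co q, q := co p)"
  have inj: "inj ?f" by (auto simp: inj_def)
  have "{x \<in> S. l x = s \<and> ?co x = Some t} = ?f ` {x \<in> S. l x = s \<and> co x = Some t}" (is "?L = ?R")
  proof
    show "?L \<subseteq> ?R"
    proof
      fix x assume "x \<in> ?L"
      then have "x = ?f (?f x)" "?f x \<in> {x \<in> S. l x = s \<and> co x = Some t}"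
        using assms by (auto split: if_splits)
      then show "x \<in> ?R" by (rule image_eqI)
    qed
    show "?R \<subseteq> ?L" using assms by auto
  qed
  then show "finite ?L \<and> card ?L = flow N s (l t)"
    using pre_count[OF st] card_image[OF inj_on_subset[OF inj subset_UNIV]] by simp
qed (use assms net disj pr_in co_in lab_place lab_transition init_count post_count in
      \<open>auto split: if_splits\<close>)

text \<open>A path from \<open>p\<close> to \<open>q\<close> leaves through the consumer
  \<open>t\<close> of \<open>p\<close> and arrives through the producer \<open>u\<close> of
  \<open>q\<close>, which forces \<open>pos t \<le> pos u\<close>.\<close>

lemma unordered:
  fixes pos :: "'c \<Rightarrow> nat"
  assumes less: "\<And>t u. link S pr co t u \<Longrightarrow> pos t < pos u"
    and "p \<in> S" "q \<in> S" "\<And>t u. co p = Some t \<Longrightarrow> pr q = Some u \<Longrightarrow> pos u < pos t"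
  shows "(p, q) \<notin> (arcs (cnet (process_of S T pr co l)))\<^sup>+"
proof
  let ?A = "arcs (cnet (process_of S T pr co l))"
  assume "(p, q) \<in> ?A\<^sup>+"
  then obtain t where t: "(p, t) \<in> ?A" "(t, q) \<in> ?A\<^sup>*" by (meson tranclD)
  then have co: "co p = Some t" "t \<in> T" using assms(2) pr_in disj co_in unfolding arcs_process_of by auto
  then have "t \<noteq> q" "q \<notin> T" using assms(3) disj by auto
  then have "(t, q) \<in> ?A\<^sup>+" using t by (simp add: rtrancl_eq_or_trancl)
  then have "rank pos t < rank pos q" using rank_arcs[of pos, OF less] by blast
  \<comment> \<open>The rank of \<open>t\<close> is \<open>2 * pos t + 1\<close>. So
    \<open>q\<close> is not initial, and its rank \<open>2 * pos u + 2\<close> is larger only if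
    \<open>pos t \<le> pos u\<close>.\<close>
  then obtain u where "pr q = Some u" "pos t \<le> pos u"
    using co \<open>q \<notin> T\<close> by (auto simp: rank_def split: option.splits)
  then show False using assms(4)[of t u] co by simp
qed

lemma isomorphic_refl: "isomorphic P P"
  unfolding isomorphic_def by (intro exI[of _ id]) auto

text \<open>After the swap the old consumer of \<open>p\<close> consumes \<open>q\<close>, so the
  producer of \<open>q\<close> precedes it in the common list. By \<open>unordered\<close> there is
  no path from \<open>p\<close> to \<open>q\<close> before the swap, and symmetrically none from
  \<open>q\<close> to \<open>p\<close>.\<close>

lemma equiv1_swap:
  assumes "lin (link S pr co) ts" "lin (link S pr (co(p := co q, q := co p))) ts" "set ts = T"
    and pq: "p \<in> S" "q \<in> S" "l p = l q"
  shows "equiv1 N (process_of S T pr co l) (process_of S T pr (co(p := co q, q := co p)) l)"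
proof -
  let ?co = "co(p := co q, q := co p)"
  interpret sw: occurrence N S T pr ?co l using occurrence_swap[OF pq] .
  obtain pos where pos: "ranks pos ts" using ranks_exists lin_distinct[OF assms(1)] by blast
  have less: "pos t < pos u" if "link S pr co t u" for t u
    using lin_iff_ranks[OF lin_distinct[OF assms(1)] pos, of "link S pr co"] assms(1,3) link_in that by blast
  have less1: "pos t < pos u" if "link S pr ?co t u" for t u
    using lin_iff_ranks[OF lin_distinct[OF assms(1)] pos, of "link S pr ?co"] assms(2,3) sw.link_in that by blast
  have "pos u < pos t" if "co p = Some t" "pr q = Some u" for t u
  proof (rule less1)
    show "link S pr ?co u t"
      unfolding link_def using that pq by (intro bexI[of _ q]) auto
  qed
  then have "(p, q) \<notin> (arcs (cnet (process_of S T pr co l)))\<^sup>+"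
    using unordered[of pos, OF less] pq by blast
  moreover have "pos u < pos t" if "co q = Some t" "pr p = Some u" for t u
  proof (rule less1)
    show "link S pr ?co u t"
      unfolding link_def using that pq by (intro bexI[of _ p]) auto
  qed
  then have "(q, p) \<notin> (arcs (cnet (process_of S T pr co l)))\<^sup>+"
    using unordered[of pos, OF less] pq by blast
  moreover have "gr_process N (process_of S T pr co l)" "gr_process N (process_of S T pr ?co l)"
    using finite_gr_process_of[OF _ assms(1,3)] sw.finite_gr_process_of[OF _ assms(2,3)] assms(3)
    unfolding finite_gr_process_def by auto
  ultimately show ?thesis
    unfolding equiv1_def using pq isomorphic_refl[of "process_of S T pr ?co l"] swap_process_of[OF pq(1,2)]
    by (intro conjI bexI[of _ p] bexI[of _ q]) auto
qed

end

text \<open>Two processes differing only in which tokens are consumed: the first transition consuming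
  different tokens can be corrected by swapping a wrong token for a right one. Both tokens exist
  before it fires and no earlier transition consumes them.\<close>

lemma equiv1_same_lin:
  assumes "occurrence N S T pr co l" "occurrence N S T pr co' l"
    and "lin (link S pr co) ts" "lin (link S pr co') ts" "set ts = T"
  shows "(equiv1 N)\<^sup>*\<^sup>* (process_of S T pr co l) (process_of S T pr co' l)"
  using assms(1,3)
proof (induction "card {p \<in> S. co p \<noteq> co' p}" arbitrary: co rule: less_induct)
  case less
  interpret A: occurrence N S T pr co l by fact
  interpret B: occurrence N S T pr co' l by fact
  have finT: "finite T" using assms(5) by auto
  let ?D = "{p \<in> S. co p \<noteq> co' p}"
  have finD: "finite ?D"
  proof (rule finite_subset)
    show "?D \<subseteq> (\<Union>t \<in> T. {p \<in> S. co p = Some t} \<union> {p \<in> S. co' p = Some t})"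
      using A.co_in B.co_in by auto (metis not_None_eq)
    show "finite (\<Union>t \<in> T. {p \<in> S. co p = Some t} \<union> {p \<in> S. co' p = Some t})"
      using finT A.finite_pre B.finite_pre by auto
  qed
  show ?case
  proof (cases "?D = {}")
    case True
    then have "process_of S T pr co l = process_of S T pr co' l"
      unfolding process_of_def by (auto simp: fun_eq_iff)
    then show ?thesis by simp
  next
    case False
    note dist = lin_distinct[OF assms(4)]
    obtain pos where pos: "ranks pos ts" using ranks_exists dist by blast
    have ltA: "pos t < pos u" if "link S pr co t u" for t u
      using lin_iff_ranks[OF dist pos, of "link S pr co"] less.prems(2) assms(5) A.link_in that by blast
    have ltB: "pos t < pos u" if "link S pr co' t u" for t u
      using lin_iff_ranks[OF dist pos, of "link S pr co'"] assms(4,5) B.link_in that by blast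
    let ?bad = "\<lambda>t. t \<in> T \<and> {p \<in> S. co p = Some t} \<noteq> {p \<in> S. co' p = Some t}"
    obtain p0 where p0: "p0 \<in> S" "co p0 \<noteq> co' p0" using False by blast
    then obtain t0 where "(co p0 = Some t0) \<noteq> (co' p0 = Some t0)"
      by (metis option.exhaust)
    moreover have "t0 \<in> T" using calculation p0 A.co_in B.co_in by blast
    ultimately have "?bad t0" using p0(1) by blast
    then obtain t where "?bad t" "\<forall>u. ?bad u \<longrightarrow> pos t \<le> pos u"
      using ex_has_least_nat[of ?bad t0 pos] by blast
    then have t: "?bad t" "\<And>u. pos u < pos t \<Longrightarrow> \<not> ?bad u" by (blast, meson leD)
    \<comment> \<open>Both presets of \<open>t\<close> have \<open>flow N s (l t)\<close> places of
      each label \<open>s\<close>. Where they differ, neither contains the other, so there are both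
      a wrong token \<open>p\<close> and a missing token \<open>q\<close>.\<close>
    have "\<exists>s. {x \<in> S. l x = s \<and> co x = Some t} \<noteq> {x \<in> S. l x = s \<and> co' x = Some t}"
      using t(1) by blast
    then obtain s where s: "{x \<in> S. l x = s \<and> co x = Some t} \<noteq> {x \<in> S. l x = s \<and> co' x = Some t}"
      (is "?A \<noteq> ?B") by blast
    have "t \<in> T" using t(1) by blast
    note cA = A.pre_count'[OF this, of s] and cB = B.pre_count'[OF this, of s]
    have "\<not> ?A \<subseteq> ?B"
    proof
      assume "?A \<subseteq> ?B"
      from card_subset_eq[OF cB(1) this] s cA(2) cB(2) show False by simp
    qed
    then obtain p where p: "p \<in> S" "l p = s" "co p = Some t" "co' p \<noteq> Some t" by blast
    have "\<not> ?B \<subseteq> ?A"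
    proof
      assume "?B \<subseteq> ?A"
      from card_subset_eq[OF cA(1) this] s cA(2) cB(2) show False by simp
    qed
    then obtain q where q: "q \<in> S" "l q = s" "co' q = Some t" "co q \<noteq> Some t" by blast
    note pq = p q
    let ?co = "co(p := co q, q := co p)"
    have "l p = l q" using pq by simp
    interpret C: occurrence N S T pr ?co l using A.occurrence_swap[OF p(1) q(1) \<open>l p = l q\<close>] .
    have inj: "inj_on pos T" using ranks_inj[OF pos] assms(5) by simp
    have "pos a < pos b" if link: "link S pr ?co a b" for a b
    proof -
      obtain x where x: "x \<in> S" "pr x = Some a" "?co x = Some b"
        using link unfolding link_def by blast
      consider "x \<noteq> p" "x \<noteq> q" | "x = q" | "x = p" "x \<noteq> q" by blast
      then show ?thesis
      proof cases
        case 1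
        then show ?thesis using x ltA[of a b] by (auto simp: link_def)
      next
        case 2
        then show ?thesis using x pq ltB[of a b] by (auto simp: link_def)
      next
        case 3
        then have b: "co q = Some b" "b \<in> T" using x A.co_in pq by auto
        \<comment> \<open>Transitions before \<open>t\<close> already consume the right tokens, and
          \<open>q\<close> belongs to \<open>t\<close> under \<open>co'\<close>. So its present
          consumer \<open>b\<close> comes after \<open>t\<close>, while the producer
          \<open>a\<close> of \<open>p\<close> comes before \<open>t\<close>.\<close>
        have "\<not> pos b < pos t"
        proof
          assume "pos b < pos t"
          then have "{p \<in> S. co p = Some b} = {p \<in> S. co' p = Some b}" using t(2) b by blast
          then have "co' q = Some b" using b q(1) by blast
          then show False using b q by simp
        qed
        moreover have "pos b \<noteq> pos t" using inj b t(1) pq by (auto dest: inj_onD)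
        moreover have "pos a < pos t" using ltA[of a t] x 3 pq by (auto simp: link_def)
        ultimately show ?thesis by simp
      qed
    qed
    then have L: "lin (link S pr ?co) ts"
      using lin_iff_ranks[OF dist pos, of "link S pr ?co"] C.link_in assms(5) by blast
    have "equiv1 N (process_of S T pr co l) (process_of S T pr ?co l)"
      using A.equiv1_swap[OF less.prems(2) L assms(5)] pq by simp
    \<comment> \<open>The swap makes \<open>q\<close> right, and \<open>p\<close> was wrong before,
      so no new difference arises.\<close>
    moreover have "{x \<in> S. ?co x \<noteq> co' x} \<subset> ?D"
    proof (rule psubsetI)
      show "{x \<in> S. ?co x \<noteq> co' x} \<subseteq> ?D"
      proof
        fix x assume "x \<in> {x \<in> S. ?co x \<noteq> co' x}"
        then show "x \<in> ?D" using p q by (cases "x = p"; cases "x = q") simp_all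
      qed
      have "q \<in> ?D" "q \<notin> {x \<in> S. ?co x \<noteq> co' x}" using p q by simp_all
      then show "{x \<in> S. ?co x \<noteq> co' x} \<noteq> ?D" by blast
    qed
    then have "(equiv1 N)\<^sup>*\<^sup>* (process_of S T pr ?co l) (process_of S T pr co' l)"
      by (intro less.hyps psubset_card_mono finD C.occurrence_axioms L)
    ultimately show ?thesis by (rule converse_rtranclp_into_rtranclp)
  qed
qed

text \<open>If both adjacent transitions are enabled, each token passed from the first to the second can
  be swapped for one that neither of them touches.\<close>

lemma equiv1_transpose:
  assumes "occurrence N S T pr co l"
    and "lin (link S pr co) (xs @ [a, b] @ ys)" "set (xs @ [a, b] @ ys) = T"
    and "fires N (init N) (map l xs) M" "step N M {#l a, l b#} M'"
  shows "\<exists>co'. occurrence N S T pr co' l \<and> lin (link S pr co') (xs @ [b, a] @ ys) \<and>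
    (equiv1 N)\<^sup>*\<^sup>* (process_of S T pr co l) (process_of S T pr co' l)"
  using assms(1,2)
proof (induction "card {p \<in> S. pr p = Some a \<and> co p = Some b}" arbitrary: co rule: less_induct)
  case less
  interpret A: occurrence N S T pr co l by fact
  let ?ts = "xs @ [a, b] @ ys" and ?D = "{p \<in> S. pr p = Some a \<and> co p = Some b}"
  have ab: "a \<in> T" "b \<in> T" "a \<noteq> b" "set xs \<subseteq> T" "a \<notin> set xs" "b \<notin> set xs"
    unfolding assms(3)[symmetric] using lin_distinct[OF less.prems(2)] by simp_all blast
  have finD: "finite ?D" using A.finite_post[OF ab(1)] by (rule finite_subset[rotated]) auto
  show ?case
  proof (cases "?D = {}")
    case True
    then have "\<not> link S pr co a b" unfolding link_def by blast
    then show ?thesis using lin_transpose[OF less.prems(2)] less.prems(1) by blast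
  next
    case False
    then obtain p where p: "p \<in> S" "pr p = Some a" "co p = Some b" by blast
    note dist = lin_distinct[OF less.prems(2)]
    obtain pos where pos: "ranks pos ?ts" using ranks_exists dist by blast
    have lt: "pos t < pos u" if "link S pr co t u" for t u
      using lin_iff_ranks[OF dist pos, of "link S pr co"] less.prems(2) assms(3) A.link_in that by blast
    let ?W = "{x \<in> A.cut (set xs). l x = l p}"
    let ?P = "\<lambda>t. {x \<in> S. l x = l p \<and> co x = Some t}"
    have M: "M = A.marking (set xs)"
      using fires_det[OF assms(4) A.fires_lin[OF lin_append1[OF less.prems(2)] ab(4)]] .
    have "pre_mset N {#l a, l b#} (l p) \<le> M (l p)"
      using assms(5) unfolding step_def le_fun_def by blast
    then have "flow N (l p) (l a) + flow N (l p) (l b) \<le> card ?W"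
      unfolding M by (simp add: pre_mset_def A.marking_def pre_def)
    \<comment> \<open>The token \<open>p\<close> counts towards the demand of \<open>b\<close> but
      is absent from \<open>?W\<close>, since \<open>a\<close> produces it. So \<open>a\<close> and
      \<open>b\<close> take fewer tokens from \<open>?W\<close> than their joint demand, which
      \<open>?W\<close> meets; some token \<open>q\<close> of \<open>?W\<close> is left
      untouched.\<close>
    moreover have "card (?P a \<union> (?P b - {p})) < flow N (l p) (l a) + flow N (l p) (l b)"
    proof -
      have "card (?P a \<union> (?P b - {p})) \<le> card (?P a) + card (?P b - {p})" by (rule card_Un_le)
      also have "\<dots> < card (?P a) + card (?P b)"
      proof (intro add_strict_left_mono card_Diff1_less)
        show "finite (?P b)" by (rule A.pre_count'(1)[OF ab(2)])
        show "p \<in> ?P b" using p by simp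
      qed
      finally show ?thesis unfolding A.pre_count'(2)[OF ab(1)] A.pre_count'(2)[OF ab(2)] .
    qed
    ultimately have "card (?P a \<union> (?P b - {p})) < card ?W" by linarith
    moreover have "finite (?P a \<union> (?P b - {p}))"
      by (intro finite_UnI finite_Diff A.pre_count'(1)[OF ab(1)] A.pre_count'(1)[OF ab(2)])
    from card_mono[OF this, of ?W] calculation have "\<not> ?W \<subseteq> ?P a \<union> (?P b - {p})"
      by linarith
    moreover have "p \<notin> ?W" using p ab unfolding A.cut_def by auto
    moreover have "?W \<subseteq> S" unfolding A.cut_def by blast
    ultimately obtain q where q: "q \<in> ?W" "co q \<noteq> Some a" "co q \<noteq> Some b" "q \<noteq> p"
      by blast
    then have qS: "q \<in> S" "l p = l q" unfolding A.cut_def by auto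
    let ?co = "co(p := co q, q := co p)"
    interpret C: occurrence N S T pr ?co l using A.occurrence_swap[OF p(1) qS] .
    have "pos t < pos u" if link: "link S pr ?co t u" for t u
    proof -
      obtain x where x: "x \<in> S" "pr x = Some t" "?co x = Some u"
        using link unfolding link_def by blast
      consider "x \<noteq> p" "x \<noteq> q" | "x = q" | "x = p" by blast
      then show ?thesis
      proof cases
        case 1
        then show ?thesis using x lt[of t u] by (auto simp: link_def)
      next
        case 2
        then have "u = b" "t \<in> set xs" using x p q unfolding A.cut_def by auto
        then show ?thesis using ranks_less[OF pos, of t u] by simp
      next
        \<comment> \<open>Now \<open>p\<close> has the consumer of \<open>q\<close>. It is not in
          \<open>xs\<close> because \<open>q\<close> is in the cut, and it is neither
          \<open>a\<close> nor \<open>b\<close>; so it lies in \<open>ys\<close>, after the producer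
          \<open>a\<close> of \<open>p\<close>.\<close>
        case 3
        then have "t = a" "co q = Some u" using x p q by auto
        then have "u \<in> T" "u \<notin> set xs" "u \<noteq> a" "u \<noteq> b"
          using q qS A.co_in unfolding A.cut_def by auto
        then have "u \<in> set ys" using assms(3) by auto
        then show ?thesis using ranks_less[of pos "xs @ [a, b]" ys t u] pos \<open>t = a\<close> by simp
      qed
    qed
    then have L: "lin (link S pr ?co) ?ts"
      using lin_iff_ranks[OF dist pos, of "link S pr ?co"] C.link_in assms(3) by blast
    have "equiv1 N (process_of S T pr co l) (process_of S T pr ?co l)"
      using A.equiv1_swap[OF less.prems(2) L assms(3)] p qS by simp
    moreover have "{p \<in> S. pr p = Some a \<and> ?co p = Some b} \<subset> ?D"
    proof -
      \<comment> \<open>As \<open>q\<close> exists before \<open>a\<close> fires, giving it to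
        \<open>b\<close> creates no new link from \<open>a\<close> to \<open>b\<close>.\<close>
      have "pr q \<noteq> Some a" using q ab unfolding A.cut_def by auto
      then have "x \<in> ?D" if "x \<in> {p \<in> S. pr p = Some a \<and> ?co p = Some b}" for x
        using that q p by (cases "x = p"; cases "x = q") simp_all
      moreover have "p \<in> ?D" "p \<notin> {p \<in> S. pr p = Some a \<and> ?co p = Some b}"
        using p q by simp_all
      ultimately show ?thesis by blast
    qed
    note less.hyps[OF psubset_card_mono[OF finD this] C.occurrence_axioms L]
    then obtain co' where "occurrence N S T pr co' l" "lin (link S pr co') (xs @ [b, a] @ ys)"
      "(equiv1 N)\<^sup>*\<^sup>* (process_of S T pr ?co l) (process_of S T pr co' l)" by blast
    ultimately show ?thesis by (meson converse_rtranclp_into_rtranclp)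
  qed
qed

section \<open>Isomorphisms\<close>

lemma lin_map:
  assumes "lin R ts" "inj_on \<phi> (set ts)"
    and "\<And>x u. u \<in> set ts \<Longrightarrow> R' x (\<phi> u) \<Longrightarrow> \<exists>t. x = \<phi> t \<and> R t u"
  shows "lin R' (map \<phi> ts)"
  using assms
proof (induction ts rule: rev_induct)
  case Nil
  then show ?case by simp
next
  case (snoc u ts)
  have "x \<in> \<phi> ` set ts" if "R' x (\<phi> u)" for x
  proof -
    have "\<exists>t. x = \<phi> t \<and> R t u" using snoc.prems(3) that by simp
    then show ?thesis using snoc.prems(1) by auto
  qed
  moreover have "lin R' (map \<phi> ts)"
    using snoc.prems by (intro snoc.IH) (auto intro: inj_on_subset)
  ultimately show ?case using snoc.prems(1,2) by auto
qed

text \<open>The target type may differ from the source type, so this serves both isomorphisms and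
  the copy into \<open>'b + nat\<close>.\<close>

locale occurrence_renaming = occurrence N S T pr co l
  for N :: "'a net" and S T :: "'c set" and pr co l +
  fixes \<phi> :: "'c \<Rightarrow> 'd" and S' T' pr' co' and l' :: "'d \<Rightarrow> 'a"
  assumes inj: "inj_on \<phi> (S \<union> T)"
    and S': "S' = \<phi> ` S" and T': "T' = \<phi> ` T"
    and l': "\<And>x. x \<in> S \<union> T \<Longrightarrow> l' (\<phi> x) = l x"
    and pr': "\<And>p. p \<in> S \<Longrightarrow> pr' (\<phi> p) = map_option \<phi> (pr p)"
    and co': "\<And>p. p \<in> S \<Longrightarrow> co' (\<phi> p) = map_option \<phi> (co p)"
begin

lemma phi_eq: "x \<in> S \<union> T \<Longrightarrow> y \<in> S \<union> T \<Longrightarrow> \<phi> x = \<phi> y \<longleftrightarrow> x = y"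
  using inj by (auto dest: inj_onD)

lemma pr'_iff: "p \<in> S \<Longrightarrow> t \<in> S \<union> T \<Longrightarrow> pr' (\<phi> p) = Some (\<phi> t) \<longleftrightarrow> pr p = Some t"
  using pr'[of p] phi_eq pr_in by (cases "pr p") auto

lemma co'_iff: "p \<in> S \<Longrightarrow> t \<in> S \<union> T \<Longrightarrow> co' (\<phi> p) = Some (\<phi> t) \<longleftrightarrow> co p = Some t"
  using co'[of p] phi_eq co_in by (cases "co p") auto

lemma pr'_None: "p \<in> S \<Longrightarrow> pr' (\<phi> p) = None \<longleftrightarrow> pr p = None"
  using pr'[of p] by simp

lemma card_phi: "A \<subseteq> S \<Longrightarrow> card (\<phi> ` A) = card A"
  using inj by (intro card_image) (auto intro: inj_on_subset)

lemma occurrence': "occurrence N S' T' pr' co' l'"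
proof
  show "S' \<inter> T' = {}"
    unfolding S' T' using disj phi_eq by blast
  show "t \<in> T'" if "p \<in> S'" "pr' p = Some t" for p t
    using that pr' pr_in unfolding S' T' by auto
  show "t \<in> T'" if "p \<in> S'" "co' p = Some t" for p t
    using that co' co_in unfolding S' T' by auto
  fix s assume s: "s \<in> places N"
  have "{p \<in> S'. l' p = s \<and> pr' p = None} = \<phi> ` {p \<in> S. l p = s \<and> pr p = None}"
    unfolding S' using l' pr'_None by auto
  then show "finite {p \<in> S'. l' p = s \<and> pr' p = None} \<and>
      card {p \<in> S'. l' p = s \<and> pr' p = None} = init N s"
    using init_count[OF s] by (simp add: card_phi)
  fix t' assume "t' \<in> T'"
  then obtain t where t: "t \<in> T" "t' = \<phi> t" unfolding T' by blast
  have "{p \<in> S'. l' p = s \<and> pr' p = Some t'} = \<phi> ` {p \<in> S. l p = s \<and> pr p = Some t}"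
    unfolding S' t(2) using l' pr'_iff t(1) by auto
  then show "finite {p \<in> S'. l' p = s \<and> pr' p = Some t'} \<and>
      card {p \<in> S'. l' p = s \<and> pr' p = Some t'} = flow N (l' t') s"
    using post_count[OF s t(1)] t l' by (simp add: card_phi)
  have "{p \<in> S'. l' p = s \<and> co' p = Some t'} = \<phi> ` {p \<in> S. l p = s \<and> co p = Some t}"
    unfolding S' t(2) using l' co'_iff t(1) by auto
  then show "finite {p \<in> S'. l' p = s \<and> co' p = Some t'} \<and>
      card {p \<in> S'. l' p = s \<and> co' p = Some t'} = flow N s (l' t')"
    using pre_count[OF s t(1)] t l' by (simp add: card_phi)
qed (use net lab_place lab_transition l' S' T' in auto)

lemma lin_renaming:
  assumes "lin (link S pr co) ts" "set ts = T"
  shows "lin (link S' pr' co') (map \<phi> ts)"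
proof (rule lin_map[OF assms(1)])
  show "inj_on \<phi> (set ts)" using inj assms(2) by (auto intro: inj_on_subset)
  show "\<exists>t. x = \<phi> t \<and> link S pr co t u" if u: "u \<in> set ts" "link S' pr' co' x (\<phi> u)" for x u
  proof -
    obtain p where p: "p \<in> S" "pr' (\<phi> p) = Some x" "co' (\<phi> p) = Some (\<phi> u)"
      using u(2) unfolding link_def S' by blast
    then have "co p = Some u" using co'_iff u(1) assms(2) by auto
    moreover obtain t where "pr p = Some t" "x = \<phi> t" using p pr' by auto
    ultimately show ?thesis using p(1) unfolding link_def by blast
  qed
qed

end

lemma isomorphic_renaming:
  fixes \<phi> :: "'c \<Rightarrow> 'c"
  assumes "occurrence_renaming N S T pr co l \<phi> S' T' pr' co' l'"
  shows "isomorphic (process_of S T pr co l) (process_of S' T' pr' co' l')"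
proof -
  interpret R: occurrence_renaming N S T pr co l \<phi> S' T' pr' co' l' by fact
  have mem: "\<phi> x \<in> S' \<longleftrightarrow> x \<in> S" if "x \<in> S \<union> T" for x
    unfolding R.S' using R.phi_eq that by blast
  have "bij_betw \<phi> (elems (process_of S T pr co l)) (elems (process_of S' T' pr' co' l'))"
    using R.inj unfolding elems_def R.S' R.T' bij_betw_def by (simp add: image_Un)
  moreover have "flow (cnet (process_of S' T' pr' co' l')) (\<phi> x) (\<phi> y) = flow (cnet (process_of S T pr co l)) x y"
    if "x \<in> S \<union> T" "y \<in> S \<union> T" for x y
    using that mem R.pr'_iff[of y x] R.co'_iff[of x y] by auto
  moreover have "init (cnet (process_of S' T' pr' co' l')) (\<phi> p) = init (cnet (process_of S T pr co l)) p"
    if "p \<in> S" for p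
    using that mem R.pr'_None by auto
  ultimately show ?thesis
    unfolding isomorphic_def elems_def using R.S' R.T' R.l'
    by (intro exI[of _ \<phi>]) (simp del: process_of_simps(3,4))
qed

text \<open>Every \<open>equiv1\<close> step contains a swap; here a place is swapped with itself,
  which changes nothing and is permitted since the causal order is irreflexive. This is where
  \<open>S \<noteq> {}\<close> enters.\<close>

lemma equiv1_renaming:
  fixes \<phi> :: "'c \<Rightarrow> 'c"
  assumes "occurrence_renaming N S T pr co l \<phi> S' T' pr' co' l'"
    and "lin (link S pr co) ts" "set ts = T" "S \<noteq> {}"
  shows "equiv1 N (process_of S T pr co l) (process_of S' T' pr' co' l')"
proof -
  interpret R: occurrence_renaming N S T pr co l \<phi> S' T' pr' co' l' by fact
  interpret R': occurrence N S' T' pr' co' l' by (rule R.occurrence')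
  obtain p where p: "p \<in> S" using assms(4) by blast
  have fin: "finite T" "finite T'" using assms(3) R.T' by auto
  have gr: "gr_process N (process_of S T pr co l)"
    using R.finite_gr_process_of[OF fin(1) assms(2,3)] by (simp add: finite_gr_process_def)
  have "gr_process N (process_of S' T' pr' co' l')"
    using R'.finite_gr_process_of[OF fin(2) R.lin_renaming[OF assms(2,3)]] assms(3) R.T'
    by (simp add: finite_gr_process_def)
  moreover have "(p, p) \<notin> (arcs (cnet (process_of S T pr co l)))\<^sup>+"
    using gr unfolding gr_process_def is_causal_net_def irrefl_def by blast
  moreover have "swap (process_of S T pr co l) p p = process_of S T pr co l"
    using R.swap_process_of[OF p p] by simp
  ultimately show ?thesis
    unfolding equiv1_def using gr p isomorphic_renaming[OF assms(1)]
    by (intro conjI bexI[of _ p]) auto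
qed

text \<open>Transitions are matched by their position in the word and places by label and producer.
  The resulting renaming respects everything except consumers, and \<open>equiv1_same_lin\<close>
  corrects those.\<close>

lemma equiv1_same_word:
  assumes "occurrence N S T pr co l" "occurrence N S' T' pr' co' l'"
    and A: "lin (link S pr co) ts" "set ts = T"
    and B: "lin (link S' pr' co') ts'" "set ts' = T'"
    and word: "map l ts = map l' ts'" and "S \<noteq> {}"
  shows "(equiv1 N)\<^sup>*\<^sup>* (process_of S T pr co l) (process_of S' T' pr' co' l')"
proof -
  interpret A: occurrence N S T pr co l by fact
  interpret B: occurrence N S' T' pr' co' l' by fact
  have len: "length ts = length ts'" using word by (metis length_map)
  obtain pos where pos: "ranks pos ts" using ranks_exists lin_distinct[OF A(1)] by blast
  define f where "f t = ts' ! pos t" for t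
  have map_f: "map f ts = ts'"
    using pos len unfolding ranks_def f_def by (intro nth_equalityI) auto
  have fT: "f ` T = T'" using map_f A(2) B(2) by (metis set_map)
  have inj_f: "inj_on f T"
    using map_f lin_distinct[OF B(1)] A(2) by (metis distinct_map)
  have lf: "l' (f t) = l t" if "t \<in> T" for t
  proof -
    have "map (l' \<circ> f) ts = map l ts" using word map_f by (metis map_map)
    then show ?thesis using that A(2) by auto
  qed
  let ?A = "\<lambda>s x. {p \<in> S. l p = s \<and> pr p = x}" and ?B = "\<lambda>s x. {p \<in> S'. l' p = s \<and> pr' p = x}"
  \<comment> \<open>How many places have label \<open>s\<close> and producer \<open>x\<close>
    depends only on \<open>s\<close> and the label of \<open>x\<close>, which \<open>f\<close>
    preserves.\<close>
  have "\<exists>h. bij_betw h (?A s x) (?B s (map_option f x))" if "x \<in> insert None (Some ` T)" for s x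
  proof (cases x)
    case None
    then show ?thesis
      using finite_same_card_bij[OF A.init_count'(1)[of s] B.init_count'(1)[of s]]
      unfolding A.init_count'(2) B.init_count'(2) by simp
  next
    case (Some t)
    then have t: "t \<in> T" using that by auto
    then have ft: "f t \<in> T'" using fT by blast
    show ?thesis
      using finite_same_card_bij[OF A.post_count'(1)[OF t, of s] B.post_count'(1)[OF ft, of s]]
      unfolding A.post_count'(2)[OF t] B.post_count'(2)[OF ft] lf[OF t] Some by simp
  qed
  note bij_ex = this
  define h where "h s x = (SOME h. bij_betw h (?A s x) (?B s (map_option f x)))" for s x
  have h: "bij_betw (h s x) (?A s x) (?B s (map_option f x))" if "x \<in> insert None (Some ` T)" for s x
    unfolding h_def by (rule someI_ex[OF bij_ex[OF that]])
  define \<phi> where "\<phi> y = (if y \<in> T then f y else h (l y) (pr y) y)" for y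
  have \<phi>T: "\<phi> t = f t" if "t \<in> T" for t using that by (simp add: \<phi>_def)
  have \<phi>S: "\<phi> p = h (l p) (pr p) p" if "p \<in> S" for p
    using that A.disj by (auto simp: \<phi>_def)
  have range: "pr p \<in> insert None (Some ` T)" if "p \<in> S" for p
    using A.pr_in[OF that] by (cases "pr p") auto
  have img: "\<phi> p \<in> S'" "l' (\<phi> p) = l p" "pr' (\<phi> p) = map_option f (pr p)" if "p \<in> S" for p
  proof -
    have "h (l p) (pr p) p \<in> ?B (l p) (map_option f (pr p))"
      using bij_betw_apply[OF h[OF range[OF that], of "l p"], of p] that by simp
    then show "\<phi> p \<in> S'" "l' (\<phi> p) = l p" "pr' (\<phi> p) = map_option f (pr p)"
      unfolding \<phi>S[OF that] by simp_all
  qed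
  have opt: "map_option f x = map_option f y \<longleftrightarrow> x = y"
    if "x \<in> insert None (Some ` T)" "y \<in> insert None (Some ` T)" for x y
    using that inj_on_eq_iff[OF inj_f] by (cases x; cases y) auto
  have "inj_on \<phi> S"
  proof (rule inj_onI)
    fix p q assume pq: "p \<in> S" "q \<in> S" "\<phi> p = \<phi> q"
    have "l p = l q" using img(2)[OF pq(1)] img(2)[OF pq(2)] pq(3) by simp
    moreover have "map_option f (pr p) = map_option f (pr q)"
      using img(3)[OF pq(1)] img(3)[OF pq(2)] pq(3) by simp
    then have "pr p = pr q" using opt[OF range[OF pq(1)] range[OF pq(2)]] by blast
    ultimately have eq: "l p = l q" "pr p = pr q" .
    have "inj_on (h (l p) (pr p)) (?A (l p) (pr p))"
      using h[OF range[OF pq(1)]] by (rule bij_betw_imp_inj_on)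
    moreover have "h (l p) (pr p) p = h (l p) (pr p) q"
      using \<phi>S[OF pq(1)] \<phi>S[OF pq(2)] pq(3) eq by simp
    moreover have "p \<in> ?A (l p) (pr p)" "q \<in> ?A (l p) (pr p)" using pq eq by simp_all
    ultimately show "p = q" by (rule inj_onD)
  qed
  moreover have "inj_on \<phi> T" using inj_f \<phi>T by (simp add: inj_on_def)
  moreover have "\<phi> ` S \<inter> \<phi> ` T = {}" using img(1) \<phi>T fT B.disj by force
  ultimately have inj: "inj_on \<phi> (S \<union> T)" unfolding inj_on_Un by blast
  have surj: "\<phi> ` S = S'"
  proof (intro equalityI subsetI)
    fix q assume q: "q \<in> S'"
    obtain x where x: "x \<in> insert None (Some ` T)" "map_option f x = pr' q"
    proof (cases "pr' q")
      case None
      then show ?thesis using that[of None] by simp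
    next
      case (Some t')
      then obtain t where "t \<in> T" "t' = f t" using B.pr_in[OF q] fT by blast
      then show ?thesis using that[of "Some t"] Some by simp
    qed
    have "q \<in> ?B (l' q) (map_option f x)" using q x by simp
    then have "q \<in> h (l' q) x ` ?A (l' q) x"
      by (simp only: bij_betw_imp_surj_on[OF h[OF x(1)]])
    then obtain p where p: "q = h (l' q) x p" "p \<in> ?A (l' q) x" by (rule imageE)
    then have "\<phi> p = q" using \<phi>S[of p] by (metis (mono_tags, lifting) mem_Collect_eq)
    then show "q \<in> \<phi> ` S" using p by blast
  qed (use img(1) in blast)
  \<comment> \<open>The consumers of the first process transported along \<open>\<phi>\<close>; they
    may differ from \<open>co'\<close>.\<close>
  define co2 where "co2 q = map_option \<phi> (co (inv_into S \<phi> q))" for q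
  interpret R: occurrence_renaming N S T pr co l \<phi> S' T' pr' co2 l'
  proof
    show "T' = \<phi> ` T" using fT \<phi>T by simp
    show "l' (\<phi> x) = l x" if "x \<in> S \<union> T" for x using that img lf \<phi>T by auto
    show "pr' (\<phi> p) = map_option \<phi> (pr p)" if "p \<in> S" for p
      using img(3)[OF that] \<phi>T A.pr_in[OF that] by (cases "pr p") auto
    show "co2 (\<phi> p) = map_option \<phi> (co p)" if "p \<in> S" for p
      using that \<open>inj_on \<phi> S\<close> by (simp add: co2_def)
  qed (use inj surj in auto)
  have "map \<phi> ts = ts'" using map_f \<phi>T A(2) by (metis map_cong)
  then have L: "lin (link S' pr' co2) ts'" using R.lin_renaming[OF A] by simp
  have "equiv1 N (process_of S T pr co l) (process_of S' T' pr' co2 l')"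
    using equiv1_renaming[OF R.occurrence_renaming_axioms A \<open>S \<noteq> {}\<close>] .
  moreover have "(equiv1 N)\<^sup>*\<^sup>* (process_of S' T' pr' co2 l') (process_of S' T' pr' co' l')"
    using equiv1_same_lin[OF R.occurrence' assms(2) L B] .
  ultimately show ?thesis by (rule converse_rtranclp_into_rtranclp)
qed

text \<open>A word does not tell equally labelled transitions apart, so the list is carried along to
  identify the two transitions exchanged by each adjacency.\<close>

lemma equiv1_if_adj0:
  assumes "(adj0 N)\<^sup>*\<^sup>* \<sigma> \<rho>" "occurrence N S T pr co l" "lin (link S pr co) ts" "set ts = T"
    "map l ts = \<sigma>"
  shows "\<exists>co' ts'. occurrence N S T pr co' l \<and> lin (link S pr co') ts' \<and> set ts' = T \<and>
    map l ts' = \<rho> \<and> (equiv1 N)\<^sup>*\<^sup>* (process_of S T pr co l) (process_of S T pr co' l)"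
  using assms(1)
proof (induction rule: rtranclp_induct)
  case base
  then show ?case using assms by blast
next
  case (step \<rho> \<rho>')
  then obtain co' ts' where IH: "occurrence N S T pr co' l" "lin (link S pr co') ts'" "set ts' = T"
    "map l ts' = \<rho>" "(equiv1 N)\<^sup>*\<^sup>* (process_of S T pr co l) (process_of S T pr co' l)" by blast
  obtain \<sigma>1 \<sigma>2 t u M M' where w: "\<rho> = \<sigma>1 @ [t, u] @ \<sigma>2" "\<rho>' = \<sigma>1 @ [u, t] @ \<sigma>2"
    "fires N (init N) \<sigma>1 M" "step N M {#t, u#} M'"
    using step.hyps(2) unfolding adj0_def by blast
  then obtain xs a b ys where ts': "ts' = xs @ [a, b] @ ys" "map l xs = \<sigma>1" "l a = t" "l b = u"
    "map l ys = \<sigma>2"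
    using IH(4) by (auto simp: map_eq_append_conv map_eq_Cons_conv)
  then obtain co'' where "occurrence N S T pr co'' l" "lin (link S pr co'') (xs @ [b, a] @ ys)"
    "(equiv1 N)\<^sup>*\<^sup>* (process_of S T pr co' l) (process_of S T pr co'' l)"
    using equiv1_transpose[OF IH(1), of xs a b ys M M'] IH(2,3) w(3,4) by auto
  moreover have "set (xs @ [b, a] @ ys) = T"
    unfolding IH(3)[symmetric] ts'(1) by auto
  moreover have "map l (xs @ [b, a] @ ys) = \<rho>'"
    unfolding w(2) using ts' by simp
  ultimately show ?case using rtranclp_trans[OF IH(5)] by blast
qed


section \<open>Prefixes and extensions\<close>

lemma process_prefix_iff:
  fixes P P' :: "('b, 'a) process"
  shows
  "process_prefix P' P \<longleftrightarrow>
     places (cnet P') \<subseteq> places (cnet P) \<and> transitions (cnet P') \<subseteq> transitions (cnet P) \<and>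
     init (cnet P') = init (cnet P) \<and>
     (\<forall>s \<in> places (cnet P'). \<forall>t \<in> transitions (cnet P').
        flow (cnet P') s t = flow (cnet P) s t \<and> flow (cnet P') t s = flow (cnet P) t s) \<and>
     (\<forall>s \<in> places (cnet P'). lab P' s = lab P s) \<and>
     (\<forall>t \<in> transitions (cnet P'). lab P' t = lab P t)"
proof -
  have "(\<forall>(x, y) \<in> A \<times> B \<union> B \<times> A. R x y) \<longleftrightarrow> (\<forall>x \<in> A. \<forall>y \<in> B. R x y \<and> R y x)"
    for A B and R :: "'b \<Rightarrow> 'b \<Rightarrow> bool"
    by auto
  then show ?thesis unfolding process_prefix_def elems_def by (simp add: ball_Un)
qed

lemma process_prefix_trans:
  assumes "process_prefix P1 P2" "process_prefix P2 P3"
  shows "process_prefix P1 P3"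
  using assms unfolding process_prefix_iff by (simp add: subset_iff)

lemma process_prefix_between:
  assumes "process_prefix P1 P3" "process_prefix P2 P3"
    "places (cnet P1) \<subseteq> places (cnet P2)" "transitions (cnet P1) \<subseteq> transitions (cnet P2)"
  shows "process_prefix P1 P2"
  using assms unfolding process_prefix_iff by (simp add: subset_iff)

text \<open>Equal initial markings detect a missing producer, and an existing producer lies in
  \<open>T\<close>; so producers agree outright. Consumers agree only within \<open>T\<close>,
  because the larger process may consume final places of the prefix.\<close>

lemma prefix_process_ofD:
  assumes "occurrence N S T pr co l" "occurrence N S' T' pr' co' l'"
    and pre: "process_prefix (process_of S T pr co l) (process_of S' T' pr' co' l')"
  shows "S \<subseteq> S'" "T \<subseteq> T'" "\<And>p. p \<in> S \<Longrightarrow> pr' p = pr p"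
    "\<And>p t. p \<in> S \<Longrightarrow> t \<in> T \<Longrightarrow> co' p = Some t \<longleftrightarrow> co p = Some t"
    "\<And>x. x \<in> S \<union> T \<Longrightarrow> l' x = l x"
proof -
  interpret A: occurrence N S T pr co l by fact
  interpret B: occurrence N S' T' pr' co' l' by fact
  let ?K = "cnet (process_of S T pr co l)" and ?K' = "cnet (process_of S' T' pr' co' l')"
  note pre' = pre[unfolded process_prefix_iff process_of_simps(1,2,5)]
  show sub: "S \<subseteq> S'" "T \<subseteq> T'" using pre' by blast+
  show "l' x = l x" if "x \<in> S \<union> T" for x using pre' that by (metis UnE)
  show "pr' p = pr p" if p: "p \<in> S" for p
  proof (cases "pr p")
    case None
    then have "init ?K p = 1" using p by simp
    then have "init ?K' p = 1" using pre' by metis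
    then show ?thesis using None by (simp split: if_splits)
  next
    case (Some t)
    then have t: "t \<in> T" using A.pr_in p by blast
    have "flow ?K t p = 1" using p Some by simp
    then have "flow ?K' t p = 1" using pre' t p by metis
    moreover have "t \<notin> S'" using t sub B.disj by blast
    ultimately show ?thesis using Some by (simp split: if_splits)
  qed
  show "co' p = Some t \<longleftrightarrow> co p = Some t" if pt: "p \<in> S" "t \<in> T" for p t
  proof -
    have "flow ?K p t = flow ?K' p t" using pre' pt by blast
    moreover have "p \<in> S'" "t \<notin> S'" "t \<notin> S" using pt sub A.disj B.disj by blast+
    ultimately show ?thesis using pt(1) by (simp split: if_splits)
  qed
qed

text \<open>The preset of \<open>u\<close> is already complete in the prefix: for each label both
  presets have the same finite size and one contains the other.\<close>

lemma prefix_link: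
  assumes "occurrence N S T pr co l" "occurrence N S' T' pr' co' l'"
    and pre: "process_prefix (process_of S T pr co l) (process_of S' T' pr' co' l')"
    and "u \<in> T" "link S' pr' co' t u"
  shows "link S pr co t u"
proof -
  interpret A: occurrence N S T pr co l by fact
  interpret B: occurrence N S' T' pr' co' l' by fact
  note D = prefix_process_ofD[OF assms(1-3)]
  obtain p where p: "p \<in> S'" "pr' p = Some t" "co' p = Some u"
    using assms(5) unfolding link_def by blast
  have u: "u \<in> T'" "l' u = l u" using D \<open>u \<in> T\<close> by auto
  let ?A = "{x \<in> S. l x = l' p \<and> co x = Some u}" and ?B = "{x \<in> S'. l' x = l' p \<and> co' x = Some u}"
  have "?A \<subseteq> ?B"
  proof
    fix x assume "x \<in> ?A"
    then show "x \<in> ?B" using D(1,4,5) \<open>u \<in> T\<close> by auto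
  qed
  moreover have "card ?A = card ?B"
    unfolding A.pre_count'(2)[OF \<open>u \<in> T\<close>] B.pre_count'(2)[OF u(1)] u(2) ..
  ultimately have "?A = ?B" using card_subset_eq B.pre_count'(1)[OF u(1)] by blast
  then have "p \<in> ?A" using p by simp
  then show ?thesis using p D(3) unfolding link_def by auto
qed

lemma prefix_lin:
  assumes "occurrence N S T pr co l" "occurrence N S' T' pr' co' l'"
    and "process_prefix (process_of S T pr co l) (process_of S' T' pr' co' l')"
    and "lin (link S pr co) ts" "set ts \<subseteq> T"
  shows "lin (link S' pr' co') ts"
  using prefix_link[OF assms(1-3)] assms(4,5) by (auto intro: lin_mono)

section \<open>Prefixes generated by lists, and extensions by firing\<close>

context occurrence
begin

text \<open>All outputs of the listed transitions are kept and consumers off the list are forgotten.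
  The explicit form of \<open>S'\<close> serves to recognise smaller prefixes inside this
  one.\<close>

lemma restrict:
  assumes "lin (link S pr co) ts" "set ts \<subseteq> T"
  shows "\<exists>S' co'. occurrence N S' (set ts) pr co' l \<and> lin (link S' pr co') ts \<and>
    process_prefix (process_of S' (set ts) pr co' l) (process_of S T pr co l) \<and>
    S' = {p \<in> S. \<forall>t. pr p = Some t \<longrightarrow> t \<in> set ts}"
proof -
  let ?X = "set ts"
  define S' where "S' = {p \<in> S. \<forall>t. pr p = Some t \<longrightarrow> t \<in> ?X}"
  define co' where "co' p = (if co p \<in> Some ` ?X then co p else None)" for p
  have co': "co' p = Some t \<longleftrightarrow> co p = Some t \<and> t \<in> ?X" for p t
    unfolding co'_def by auto
  have eqs: "{p \<in> S'. l p = s \<and> pr p = None} = {p \<in> S. l p = s \<and> pr p = None}"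
    "t \<in> ?X \<Longrightarrow> {p \<in> S'. l p = s \<and> pr p = Some t} = {p \<in> S. l p = s \<and> pr p = Some t}" for s t
    unfolding S'_def by auto
  \<comment> \<open>A place consumed by \<open>u\<close> is initial or has a producer linked to
    \<open>u\<close>, which is then listed; so no preset loses a place.\<close>
  have eq3: "{p \<in> S'. l p = s \<and> co' p = Some u} = {p \<in> S. l p = s \<and> co p = Some u}"
    if "u \<in> ?X" for s u
    using lin_closed[OF assms(1) _ that] that unfolding S'_def co' link_def by auto
  have "occurrence N S' ?X pr co' l"
  proof
    show "S' \<inter> ?X = {}" using disj assms(2) unfolding S'_def by blast
    show "t \<in> ?X" if "p \<in> S'" "pr p = Some t" for p t using that unfolding S'_def by blast
    show "t \<in> ?X" if "co' p = Some t" for p t using that co' by blast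
    show "l p \<in> places N" if "p \<in> S'" for p using that lab_place unfolding S'_def by blast
    show "l t \<in> transitions N" if "t \<in> ?X" for t using that lab_transition assms(2) by blast
    show "finite {p \<in> S'. l p = s \<and> pr p = None} \<and> card {p \<in> S'. l p = s \<and> pr p = None} = init N s"
      if "s \<in> places N" for s unfolding eqs using init_count[OF that] .
    fix s t assume st: "s \<in> places N" "t \<in> ?X"
    then have "t \<in> T" using assms(2) by blast
    show "finite {p \<in> S'. l p = s \<and> pr p = Some t} \<and>
        card {p \<in> S'. l p = s \<and> pr p = Some t} = flow N (l t) s"
      unfolding eqs(2)[OF st(2)] using post_count[OF st(1) \<open>t \<in> T\<close>] .
    show "finite {p \<in> S'. l p = s \<and> co' p = Some t} \<and>
        card {p \<in> S'. l p = s \<and> co' p = Some t} = flow N s (l t)"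
      unfolding eq3[OF st(2)] using pre_count[OF st(1) \<open>t \<in> T\<close>] .
  qed (rule net)
  moreover have "lin (link S' pr co') ts"
    using assms(1) by (rule lin_mono) (auto simp: link_def S'_def co')
  moreover have "process_prefix (process_of S' ?X pr co' l) (process_of S T pr co l)"
  proof -
    have "init (cnet (process_of S' ?X pr co' l)) = init (cnet (process_of S T pr co l))"
      by (rule ext) (auto simp: S'_def)
    moreover have "flow (cnet (process_of S' ?X pr co' l)) x y = flow (cnet (process_of S T pr co l)) x y"
      if xy: "(x, y) \<in> S' \<times> ?X \<union> ?X \<times> S'" for x y
    proof -
      have "S' \<subseteq> S" unfolding S'_def by blast
      then consider "x \<in> S'" "x \<in> S" "y \<in> ?X" "y \<notin> S" "y \<notin> S'" |
        "y \<in> S'" "y \<in> S" "x \<in> ?X" "x \<notin> S" "x \<notin> S'"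
        using xy assms(2) disj by blast
      then show ?thesis by cases (simp_all add: co')
    qed
    ultimately show ?thesis
      unfolding process_prefix_def using assms(2)
      by (auto simp: S'_def simp del: process_of_simps(3,4))
  qed
  ultimately show ?thesis unfolding S'_def by blast
qed

text \<open>The list fires to the marking of \<open>cut T\<close>, which enables \<open>x\<close>.
  So a fresh transition can consume tokens chosen from this cut and produce fresh places; any choice
  with the right labels will do.\<close>

lemma extend_step:
  assumes L: "lin (link S pr co) ts" "set ts = T" and fresh: "infinite (- (S \<union> T))"
    and fire: "map l ts @ [x] \<in> FS N"
  shows "\<exists>S' T' pr' co' l' ts'. occurrence N S' T' pr' co' l' \<and> lin (link S' pr' co') ts' \<and>
    set ts' = T' \<and> map l' ts' = map l ts @ [x] \<and> infinite (- (S' \<union> T')) \<and>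
    process_prefix (process_of S T pr co l) (process_of S' T' pr' co' l')"
proof -
  obtain M M' where M: "fires N (init N) (map l ts) M" "step N M {#x#} M'"
    using fire unfolding FS_def by (auto simp: fires_append)
  have M_eq: "M = marking T" using fires_det[OF M(1) fires_lin[OF L(1)]] L(2) by simp
  have x: "x \<in> transitions N" using M(2) unfolding step_def by simp
  have fin: "finite T" using L(2) by auto
  have "flow N s x \<le> card {p \<in> cut T. l p = s}" for s
  proof -
    have "pre_mset N {#x#} s \<le> M s" using M(2) unfolding step_def le_fun_def by blast
    then show ?thesis by (simp add: pre_mset_def pre_def M_eq marking_def)
  qed
  note enough = this
  define C where "C s = (SOME C. C \<subseteq> {p \<in> cut T. l p = s} \<and> card C = flow N s x \<and> finite C)" for s
  have "C s \<subseteq> {p \<in> cut T. l p = s} \<and> card (C s) = flow N s x \<and> finite (C s)" for s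
    unfolding C_def
  proof (rule someI_ex)
    show "\<exists>C. C \<subseteq> {p \<in> cut T. l p = s} \<and> card C = flow N s x \<and> finite C"
      using obtain_subset_with_card_n[OF enough[of s]] by metis
  qed
  then have C: "\<And>s. C s \<subseteq> {p \<in> cut T. l p = s}" "\<And>s. card (C s) = flow N s x"
    "\<And>s. finite (C s)" by blast+
  \<comment> \<open>One pair per token to be produced. The fresh set \<open>Z\<close> is a copy of
    \<open>?G\<close>, and the first component of a pair is the label of its place.\<close>
  let ?G = "Sigma {s \<in> places N. flow N x s > 0} (\<lambda>s. {..<flow N x s})"
  have finG: "finite ?G"
  proof (rule finite_SigmaI)
    show "finite {s \<in> places N. flow N x s > 0}" using net x unfolding is_net_def by blast
  qed simp
  have "- (S \<union> T) \<noteq> {}" using fresh by (metis finite.emptyI)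
  then obtain t where t: "t \<notin> S \<union> T" by blast
  have "infinite (- (S \<union> T) - {t})" using fresh by (simp del: Compl_Un)
  from infinite_arbitrarily_large[OF this, of "card ?G"]
  obtain Z where Z: "finite Z" "card Z = card ?G" "Z \<subseteq> - (S \<union> T) - {t}" by blast
  obtain g where g: "bij_betw g Z ?G" using finite_same_card_bij[OF Z(1) finG Z(2)] by blast
  define S' where "S' = S \<union> Z"
  define T' where "T' = insert t T"
  define pr' where "pr' p = (if p \<in> Z then Some t else pr p)" for p
  define co' where "co' p = (if p \<in> Z then None else if p \<in> C (l p) then Some t else co p)" for p
  define l' where "l' y = (if y \<in> Z then fst (g y) else if y = t then x else l y)" for y
  have tn: "t \<notin> S" "t \<notin> T" "t \<notin> Z" using t Z(3) by blast+
  have Zn: "p \<notin> Z" if "p \<in> S \<union> T" for p using that Z(3) by blast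
  have CS: "p \<in> S" "co p = None" if "p \<in> C (l p)" for p
  proof -
    have "p \<in> cut T" using that C(1) by blast
    then show "p \<in> S" "co p = None" unfolding cut_def using co_in by (auto, cases "co p") auto
  qed
  have prS: "pr' p = pr p" "l' p = l p" if "p \<in> S" for p
    using that Zn tn by (auto simp: pr'_def l'_def)
  have prt: "pr p \<noteq> Some t" "co p \<noteq> Some t" if "p \<in> S" for p
    using pr_in[OF that] co_in[OF that] tn by auto
  have lT: "l' u = l u" if "u \<in> T" for u using that Zn tn by (auto simp: l'_def)
  have coT: "co' p = Some u \<longleftrightarrow> p \<notin> Z \<and> co p = Some u" if "u \<noteq> t" for p u
    using that CS by (auto simp: co'_def)
  have e1: "{p \<in> S'. l' p = s \<and> pr' p = None} = {p \<in> S. l p = s \<and> pr p = None}" for s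
    using prS Zn by (auto simp: S'_def pr'_def)
  have e2: "{p \<in> S'. l' p = s \<and> pr' p = Some u} = {p \<in> S. l p = s \<and> pr p = Some u}" if "u \<in> T" for s u
    using that prS tn Zn by (auto simp: S'_def pr'_def)
  have e3: "{p \<in> S'. l' p = s \<and> co' p = Some u} = {p \<in> S. l p = s \<and> co p = Some u}" if "u \<in> T" for s u
  proof -
    have "u \<noteq> t" using that tn by blast
    then show ?thesis using coT[of u] prS(2) Zn by (auto simp: S'_def)
  qed
  have e4: "{p \<in> S'. l' p = s \<and> pr' p = Some t} = {p \<in> Z. fst (g p) = s}" for s
  proof (rule set_eqI)
    fix p
    consider "p \<in> Z" | "p \<in> S" "p \<notin> Z" | "p \<notin> S" "p \<notin> Z" by blast
    then show "p \<in> {p \<in> S'. l' p = s \<and> pr' p = Some t} \<longleftrightarrow> p \<in> {p \<in> Z. fst (g p) = s}"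
      by cases (use prt(1)[of p] in \<open>simp_all add: S'_def pr'_def l'_def\<close>)
  qed
  have e5: "{p \<in> S'. l' p = s \<and> co' p = Some t} = C s" for s
  proof (rule set_eqI)
    fix p
    have Cp: "p \<in> S \<and> l p = s" if "p \<in> C s" using that C(1)[of s] CS(1)[of p] by auto
    consider "p \<in> Z" | "p \<in> S" "p \<notin> Z" | "p \<notin> S" "p \<notin> Z" by blast
    then show "p \<in> {p \<in> S'. l' p = s \<and> co' p = Some t} \<longleftrightarrow> p \<in> C s"
    proof cases
      case 1
      then show ?thesis using Cp Zn[of p] by (auto simp: co'_def)
    next
      case 2
      then have "p \<in> C (l p) \<and> l p = s \<longleftrightarrow> p \<in> C s" using Cp by blast
      then show ?thesis using 2 prt(2)[of p] prS(2)[of p] by (simp add: S'_def co'_def) blast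
    next
      case 3
      then show ?thesis using Cp by (auto simp: S'_def)
    qed
  qed
  have card_Z: "card {p \<in> Z. fst (g p) = s} = flow N x s" if s: "s \<in> places N" for s
  proof -
    have "inj_on g {p \<in> Z. fst (g p) = s}"
      by (rule inj_on_subset[OF bij_betw_imp_inj_on[OF g]]) simp
    note card_image[OF this, symmetric]
    also have "g ` {p \<in> Z. fst (g p) = s} = {y \<in> g ` Z. fst y = s}" by auto
    also have "g ` Z = ?G" using g by (rule bij_betw_imp_surj_on)
    also have "{y \<in> ?G. fst y = s} = {s} \<times> {..<flow N x s}"
      using s by (intro set_eqI) (simp add: mem_Times_iff split_beta, auto)
    finally show ?thesis by simp
  qed
  have occ: "occurrence N S' T' pr' co' l'"
  proof
    show "S' \<inter> T' = {}" using disj tn Zn unfolding S'_def T'_def by blast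
    show "u \<in> T'" if "p \<in> S'" "pr' p = Some u" for p u
      using that pr_in unfolding S'_def T'_def pr'_def by (auto split: if_splits)
    show "u \<in> T'" if "p \<in> S'" "co' p = Some u" for p u
      using that co_in unfolding S'_def T'_def co'_def by (auto split: if_splits)
    show "l' p \<in> places N" if "p \<in> S'" for p
    proof (cases "p \<in> Z")
      case True
      then have "g p \<in> ?G" using g by (auto dest: bij_betwE)
      then show ?thesis using True by (auto simp: l'_def)
    next
      case False
      then show ?thesis using that lab_place prS(2) by (auto simp: S'_def)
    qed
    show "l' u \<in> transitions N" if "u \<in> T'" for u
    proof (cases "u = t")
      case True
      then show ?thesis using x tn by (simp add: l'_def)
    next
      case False
      then have "u \<in> T" using that by (simp add: T'_def)
      then show ?thesis using lab_transition lT by simp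
    qed
    fix s assume s: "s \<in> places N"
    show "finite {p \<in> S'. l' p = s \<and> pr' p = None} \<and> card {p \<in> S'. l' p = s \<and> pr' p = None} = init N s"
      unfolding e1 using init_count[OF s] .
    fix u assume u: "u \<in> T'"
    have lt: "l' t = x" using tn by (simp add: l'_def)
    show "finite {p \<in> S'. l' p = s \<and> pr' p = Some u} \<and>
        card {p \<in> S'. l' p = s \<and> pr' p = Some u} = flow N (l' u) s"
    proof (cases "u = t")
      case True
      show ?thesis unfolding True e4 lt using card_Z[OF s] Z(1) by simp
    next
      case False
      then have "u \<in> T" using u by (simp add: T'_def)
      then show ?thesis unfolding e2[OF \<open>u \<in> T\<close>] lT[OF \<open>u \<in> T\<close>] using post_count[OF s] by blast
    qed
    show "finite {p \<in> S'. l' p = s \<and> co' p = Some u} \<and>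
        card {p \<in> S'. l' p = s \<and> co' p = Some u} = flow N s (l' u)"
    proof (cases "u = t")
      case True
      show ?thesis unfolding True e5 lt using C(2,3) by simp
    next
      case False
      then have "u \<in> T" using u by (simp add: T'_def)
      then show ?thesis unfolding e3[OF \<open>u \<in> T\<close>] lT[OF \<open>u \<in> T\<close>] using pre_count[OF s] by blast
    qed
  qed (rule net)
  have link_old: "link S pr co a u" if a: "link S' pr' co' a u" "u \<noteq> t" for a u
  proof -
    obtain p where p: "p \<in> S'" "pr' p = Some a" "co' p = Some u"
      using a(1) unfolding link_def by blast
    then have "p \<notin> Z" "co p = Some u" using coT[OF a(2)] by auto
    then have "p \<in> S" using p(1) by (simp add: S'_def)
    then show ?thesis using p \<open>co p = Some u\<close> prS(1) unfolding link_def by auto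
  qed
  have link_new: "a \<in> T" if a: "link S' pr' co' a t" for a
  proof -
    obtain p where p: "p \<in> S'" "pr' p = Some a" "co' p = Some t"
      using a unfolding link_def by blast
    then have "p \<notin> Z" by (auto simp: co'_def)
    then have "p \<in> S" using p(1) by (simp add: S'_def)
    then show ?thesis using p(2) prS(1) pr_in by auto
  qed
  have "lin (link S' pr' co') ts"
    using L tn link_old by (auto intro: lin_mono)
  then have lin': "lin (link S' pr' co') (ts @ [t])"
    using L(2) tn(2) link_new by simp
  have set': "set (ts @ [t]) = T'" using L(2) by (simp add: T'_def)
  have map': "map l' (ts @ [t]) = map l ts @ [x]"
    using lT L(2) tn(3) by (simp add: l'_def)
  \<comment> \<open>Only finitely many elements have been used up, so the construction can be
    repeated.\<close>
  have "- (S' \<union> T') = - (S \<union> T) - insert t Z" by (auto simp: S'_def T'_def)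
  then have fresh': "infinite (- (S' \<union> T'))" using fresh Z(1) by (simp del: Compl_Un)
  have "process_prefix (process_of S T pr co l) (process_of S' T' pr' co' l')"
  proof -
    have "init (cnet (process_of S T pr co l)) = init (cnet (process_of S' T' pr' co' l'))"
      using Zn by (intro ext) (auto simp: S'_def pr'_def)
    moreover have "flow (cnet (process_of S T pr co l)) a b = flow (cnet (process_of S' T' pr' co' l')) a b"
      if ab: "(a, b) \<in> S \<times> T \<union> T \<times> S" for a b
    proof -
      consider "a \<in> S" "b \<in> T" | "a \<in> T" "b \<in> S" using ab by blast
      then show ?thesis
      proof cases
        case 1
        then have "b \<notin> S" "b \<notin> S'" "a \<in> S'" "a \<notin> Z" "b \<noteq> t" using disj Zn tn by (auto simp: S'_def)
        then show ?thesis using 1 coT[of b a] by simp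
      next
        case 2
        then have "a \<notin> S" "a \<notin> S'" "b \<in> S'" using disj Zn by (auto simp: S'_def)
        then show ?thesis using 2 prS(1) by simp
      qed
    qed
    moreover have "l x = l' x" if "x \<in> S \<union> T" for x using that prS(2) lT by auto
    ultimately show ?thesis
      unfolding process_prefix_def elems_def
      by (auto simp: S'_def T'_def simp del: process_of_simps(3,4))
  qed
  with occ lin' set' map' fresh' show ?thesis by blast
qed

end

lemma extend:
  assumes "occurrence N S T pr co l" "lin (link S pr co) ts" "set ts = T" "infinite (- (S \<union> T))"
    and "map l ts @ w \<in> FS N"
  shows "\<exists>S' T' pr' co' l' ts'. occurrence N S' T' pr' co' l' \<and> lin (link S' pr' co') ts' \<and>
    set ts' = T' \<and> map l' ts' = map l ts @ w \<and> infinite (- (S' \<union> T')) \<and>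
    process_prefix (process_of S T pr co l) (process_of S' T' pr' co' l')"
  using assms(5)
proof (induction w rule: rev_induct)
  case Nil
  have "process_prefix (process_of S T pr co l) (process_of S T pr co l)" unfolding process_prefix_def by auto
  then show ?case unfolding append_Nil2 using assms(1-4) by blast
next
  case (snoc x w)
  have "map l ts @ w \<in> FS N" using snoc.prems FS_append[of "map l ts @ w" "[x]"] by simp
  then obtain S' T' pr' co' l' ts' where IH: "occurrence N S' T' pr' co' l'"
    "lin (link S' pr' co') ts'" "set ts' = T'" "map l' ts' = map l ts @ w" "infinite (- (S' \<union> T'))"
    "process_prefix (process_of S T pr co l) (process_of S' T' pr' co' l')" using snoc.IH by blast
  have "map l' ts' @ [x] \<in> FS N" using snoc.prems IH(4) by simp
  from occurrence.extend_step[OF IH(1-3,5) this]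
  obtain S2 T2 pr2 co2 l2 ts2 where "occurrence N S2 T2 pr2 co2 l2"
    "lin (link S2 pr2 co2) ts2" "set ts2 = T2" "map l2 ts2 = map l ts @ w @ [x]"
    "infinite (- (S2 \<union> T2))" "process_prefix (process_of S' T' pr' co' l') (process_of S2 T2 pr2 co2 l2)"
    unfolding IH(4) by (auto simp del: Compl_Un)
  then show ?case using process_prefix_trans[OF IH(6)] by blast
qed

section \<open>Words and linearisations\<close>

text \<open>Counterpart of \<open>link\<close> read off the flow, for processes that are not
  presented in the form \<open>process_of\<close>, such as the target of an isomorphism.\<close>

definition process_link :: "('c, 'a) process \<Rightarrow> 'c \<Rightarrow> 'c \<Rightarrow> bool" where
  "process_link P t u \<longleftrightarrow> (\<exists>p \<in> places (cnet P). flow (cnet P) t p > 0 \<and> flow (cnet P) p u > 0)"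

lemma process_link_process_of:
  assumes "occurrence N S T pr co l"
  shows "process_link (process_of S T pr co l) = link S pr co"
proof (intro ext)
  fix t u
  interpret A: occurrence N S T pr co l by fact
  have "flow (cnet (process_of S T pr co l)) t p > 0 \<longleftrightarrow> pr p = Some t"
    "flow (cnet (process_of S T pr co l)) p u > 0 \<longleftrightarrow> co p = Some u" if "p \<in> S" for p
    using that A.pr_in A.co_in A.disj by auto
  then show "process_link (process_of S T pr co l) t u = link S pr co t u"
    unfolding process_link_def link_def by (simp del: process_of_simps(3))
qed

lemma wf_if_lin:
  assumes "lin R ts" "\<And>t u. R t u \<Longrightarrow> u \<in> set ts"
  shows "wf {(t, u). R t u}"
proof -
  obtain pos where pos: "ranks pos ts" using ranks_exists lin_distinct[OF assms(1)] by blast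
  have "R t u \<Longrightarrow> pos t < pos u" for t u
    using lin_iff_ranks[OF lin_distinct[OF assms(1)] pos, of R] assms lin_closed[OF assms(1)] by blast
  then show ?thesis by (intro wf_subset[OF wf_measure[of pos]]) auto
qed

section \<open>From swaps back to adjacent firing sequences\<close>

lemma wf_link:
  assumes "occurrence N S T pr co l" "gr_process N (process_of S T pr co l)" "finite T"
  shows "wf {(t, u). link S pr co t u}"
proof (rule finite_acyclic_wf)
  interpret A: occurrence N S T pr co l by fact
  let ?A = "arcs (cnet (process_of S T pr co l))"
  have "{(t, u). link S pr co t u} \<subseteq> T \<times> T" using A.link_in by blast
  then show "finite {(t, u). link S pr co t u}" using assms(3) by (meson finite_SigmaI finite_subset)
  have "{(t, u). link S pr co t u}\<^sup>+ \<subseteq> (?A\<^sup>+)\<^sup>+"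
    using A.link_arcs by (intro trancl_mono_subset) auto
  moreover have "irrefl (?A\<^sup>+)" using assms(2) unfolding gr_process_def is_causal_net_def by blast
  ultimately show "acyclic {(t, u). link S pr co t u}"
    unfolding acyclic_def irrefl_def by (metis subsetD trancl_id trans_trancl)
qed

text \<open>Linearising all causes of \<open>p\<close> and \<open>q\<close> first yields a linearisation that also respects
  the process in which \<open>p\<close> and \<open>q\<close> have been swapped.\<close>

lemma adj0_equiv1:
  assumes "is_net N" "equiv1 N P Q" "finite (transitions (cnet P))"
    and ts: "lin (process_link P) ts" "set ts = transitions (cnet P)"
  shows "finite (transitions (cnet Q)) \<and> (\<exists>ts'. lin (process_link Q) ts' \<and>
    set ts' = transitions (cnet Q) \<and> (adj0 N)\<^sup>*\<^sup>* (map (lab P) ts) (map (lab Q) ts'))"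
proof -
  have gr: "gr_process N P" using assms(2) unfolding equiv1_def by blast
  obtain S T pr co l where P: "P = process_of S T pr co l" and occ: "occurrence N S T pr co l"
    using gr_process_decompose[OF assms(1) gr] by metis
  interpret A: occurrence N S T pr co l by fact
  have fin: "finite T" using assms(3) P by simp
  have ts: "lin (link S pr co) ts" "set ts = T" using ts P process_link_process_of[OF occ] by auto
  let ?A = "arcs (cnet (process_of S T pr co l))"
  obtain p q where pq: "p \<in> S" "q \<in> S" "(p, q) \<notin> ?A\<^sup>+" "(q, p) \<notin> ?A\<^sup>+" "l p = l q"
    and iso: "isomorphic (process_of S T pr (co(p := co q, q := co p)) l) Q"
    using assms(2) A.swap_process_of unfolding equiv1_def P by auto
  let ?co = "co(p := co q, q := co p)"
  interpret B: occurrence N S T pr ?co l using A.occurrence_swap pq by blast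
  define D where "D = {t \<in> T. (t, p) \<in> ?A\<^sup>+ \<or> (t, q) \<in> ?A\<^sup>+}"
  have closed: "t \<in> D" if "link S pr co t u" "u \<in> D" for t u
    using A.link_arcs[OF that(1)] A.link_in[OF that(1)] that(2) unfolding D_def
    by (auto intro: trancl_trans)
  have wf: "wf {(t, u). link S pr co t u}" using wf_link[OF occ] gr fin P by blast
  have "finite D" "D \<subseteq> T" using fin unfolding D_def by auto
  have "\<exists>ds. lin (link S pr co) ([] @ ds) \<and> set ([] @ ds) = D"
    using \<open>finite D\<close> wf closed by (rule lin_extend) auto
  then obtain ds where ds: "lin (link S pr co) ds" "set ds = D" by auto
  have "\<exists>us. lin (link S pr co) (ds @ us) \<and> set (ds @ us) = T"
    using fin wf _ ds(1) by (rule lin_extend) (use A.link_in \<open>D \<subseteq> T\<close> ds(2) in auto)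
  then obtain us where us: "lin (link S pr co) (ds @ us)" "set (ds @ us) = T" by blast
  note dist = lin_distinct[OF us(1)]
  obtain pos where pos: "ranks pos (ds @ us)" using ranks_exists dist by blast
  have lt: "pos t < pos u" if "link S pr co t u" for t u
    using lin_iff_ranks[OF dist pos, of "link S pr co"] us A.link_in that by blast
  have prD: "t \<in> set ds" if "x \<in> {p, q}" "pr x = Some t" for x t
  proof -
    have "(t, x) \<in> ?A\<^sup>+" using that pq unfolding A.arcs_process_of by auto
    then show ?thesis using that pq A.pr_in unfolding ds(2) D_def by auto
  qed
  \<comment> \<open>If a consumer of \<open>x\<close> were in \<open>D\<close>, then
    \<open>x\<close> would lie below \<open>p\<close> or \<open>q\<close>: below itself is excluded
    by irreflexivity, below the other because the two are unordered.\<close>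
  have coD: "u \<in> set us" if x: "x \<in> {p, q}" "co x = Some u" for x u
  proof -
    have xu: "(x, u) \<in> ?A" using x pq unfolding A.arcs_process_of by auto
    have irr: "(x, x) \<notin> ?A\<^sup>+" for x
      using gr unfolding P gr_process_def is_causal_net_def irrefl_def by blast
    have "u \<notin> D"
    proof
      assume "u \<in> D"
      then have "(x, p) \<in> ?A\<^sup>+ \<or> (x, q) \<in> ?A\<^sup>+"
        unfolding D_def using xu by (auto intro: trancl_into_trancl2)
      then show False using x(1) irr pq(3,4) by auto
    qed
    moreover have "u \<in> T" using x pq A.co_in by auto
    ultimately show ?thesis using us(2) ds(2) by auto
  qed
  \<comment> \<open>However the consumers of \<open>p\<close> and \<open>q\<close> are distributed,
    the producers are in \<open>ds\<close> and the consumers in \<open>us\<close>.\<close>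
  have "pos t < pos u" if tu: "link S pr ?co t u" for t u
  proof -
    obtain x where x: "x \<in> S" "pr x = Some t" "?co x = Some u" using tu unfolding link_def by blast
    show ?thesis
    proof (cases "x \<in> {p, q}")
      case True
      then have "\<exists>y \<in> {p, q}. co y = Some u" using x(3) by (auto split: if_splits)
      then have "u \<in> set us" using coD by blast
      moreover have "t \<in> set ds" using prD True x(2) by blast
      ultimately show ?thesis using ranks_less[OF pos] by blast
    next
      case False
      then have "link S pr co t u" using x unfolding link_def by auto
      then show ?thesis by (rule lt)
    qed
  qed
  then have L: "lin (link S pr ?co) (ds @ us)"
    using lin_iff_ranks[OF dist pos, of "link S pr ?co"] us(2) B.link_in by blast
  have adj: "(adj0 N)\<^sup>*\<^sup>* (map l ts) (map l (ds @ us))"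
    using A.adj0_lin[of "[]" ts "ds @ us"] ts us by simp
  let ?P' = "process_of S T pr ?co l"
  obtain \<phi> where \<phi>: "bij_betw \<phi> (elems ?P') (elems Q)" "\<phi> ` S = places (cnet Q)"
    "\<phi> ` T = transitions (cnet Q)"
    "\<And>x y. x \<in> elems ?P' \<Longrightarrow> y \<in> elems ?P' \<Longrightarrow> flow (cnet Q) (\<phi> x) (\<phi> y) = flow (cnet ?P') x y"
    "\<And>x. x \<in> elems ?P' \<Longrightarrow> lab ?P' x = lab Q (\<phi> x)"
    using iso unfolding isomorphic_def by auto
  have el: "elems ?P' = S \<union> T" unfolding elems_def by simp
  have "lin (process_link Q) (map \<phi> (ds @ us))"
  proof (rule lin_map)
    show "lin (process_link ?P') (ds @ us)" using L process_link_process_of[OF B.occurrence_axioms] by simp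
    show "inj_on \<phi> (set (ds @ us))"
      unfolding us(2) by (rule inj_on_subset[OF bij_betw_imp_inj_on[OF \<phi>(1)]]) (simp add: el)
    show "\<exists>t. x = \<phi> t \<and> process_link ?P' t u" if u: "u \<in> set (ds @ us)" "process_link Q x (\<phi> u)" for x u
    proof -
      have uT: "u \<in> T" using u(1) us(2) by blast
      obtain r where r: "r \<in> places (cnet Q)" "flow (cnet Q) x r > 0" "flow (cnet Q) r (\<phi> u) > 0"
        using u(2) unfolding process_link_def by blast
      obtain s where s: "s \<in> S" "r = \<phi> s" using r(1) \<phi>(2) by blast
      have netQ: "is_net (cnet Q)"
        using assms(2) unfolding equiv1_def gr_process_def is_causal_net_def by blast
      then have "(x, r) \<in> places (cnet Q) \<times> transitions (cnet Q) \<union> transitions (cnet Q) \<times> places (cnet Q)"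
        "places (cnet Q) \<inter> transitions (cnet Q) = {}"
        using r(2) unfolding is_net_def by blast+
      then have "x \<in> transitions (cnet Q)" using r(1) by blast
      then obtain t where t: "t \<in> T" "x = \<phi> t" using \<phi>(3) by blast
      have "flow (cnet ?P') t s > 0" "flow (cnet ?P') s u > 0"
        using r(2,3) \<phi>(4)[of t s] \<phi>(4)[of s u] t s uT unfolding el by (simp_all del: process_of_simps(3))
      then have "process_link ?P' t u" using s(1) unfolding process_link_def by (simp del: process_of_simps(3)) blast
      then show ?thesis using t(2) by blast
    qed
  qed
  moreover have "set (map \<phi> (ds @ us)) = transitions (cnet Q)"
    using us(2) \<phi>(3) by (metis set_map)
  moreover have "map (lab Q) (map \<phi> (ds @ us)) = map l (ds @ us)"
  proof -
    have "lab Q (\<phi> t) = l t" if "t \<in> T" for t using \<phi>(5)[of t] that unfolding el by simp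
    then show ?thesis using us(2) by auto
  qed
  moreover have "finite (transitions (cnet Q))" using fin \<phi>(3) by (metis finite_imageI)
  ultimately show ?thesis using adj unfolding P by (metis process_of_simps(5))
qed

lemma adj0_equiv1_rtranclp:
  assumes "is_net N" "(equiv1 N)\<^sup>*\<^sup>* P Q" "finite (transitions (cnet P))"
    and "lin (process_link P) ts" "set ts = transitions (cnet P)"
  shows "\<exists>ts'. finite (transitions (cnet Q)) \<and> lin (process_link Q) ts' \<and>
    set ts' = transitions (cnet Q) \<and> (adj0 N)\<^sup>*\<^sup>* (map (lab P) ts) (map (lab Q) ts')"
  using assms(2)
proof (induction rule: rtranclp_induct)
  case base
  then show ?case using assms(3-5) by blast
next
  case (step Q R)
  then obtain ts' where ts': "finite (transitions (cnet Q))" "lin (process_link Q) ts'"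
    "set ts' = transitions (cnet Q)" "(adj0 N)\<^sup>*\<^sup>* (map (lab P) ts) (map (lab Q) ts')" by blast
  from adj0_equiv1[OF assms(1) step.hyps(2) ts'(1-3)] rtranclp_trans[OF ts'(4)]
  show ?case by blast
qed

section \<open>Finite initial parts of words and of processes\<close>

lemma prefix_word_iff:
  "prefix_word xs \<sigma> \<longleftrightarrow> (\<exists>k. {..<k} \<subseteq> word_dom \<sigma> \<and> xs = map (word_nth \<sigma>) [0..<k])"
proof (cases \<sigma>)
  case (Fin ys)
  have take: "take k ys = map ((!) ys) [0..<k]" if "k \<le> length ys" for k
    using that by (intro nth_equalityI) auto
  have "prefix xs ys \<longleftrightarrow> (\<exists>k \<le> length ys. xs = take k ys)"
    by (metis prefix_def append_eq_conv_conj nat_le_linear take_all take_is_prefix prefix_length_le)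
  moreover have "{..<k} \<subseteq> {..<length ys} \<longleftrightarrow> k \<le> length ys" for k by auto
  moreover have "word_nth (Fin ys) = (!) ys" by (rule ext) simp
  ultimately show ?thesis using take Fin by auto
next
  case (Inf f)
  have "word_nth (Inf f) = f" by (rule ext) simp
  then show ?thesis using Inf by auto
qed

text \<open>The inverse of the bijection \<open>pos\<close> in \<open>compatible\<close>, described
  by its finite initial lists so that finite and infinite words are handled alike.\<close>

definition enumerates ::
    "'a word \<Rightarrow> 'c set \<Rightarrow> 'c set \<Rightarrow> ('c \<Rightarrow> 'c option) \<Rightarrow> ('c \<Rightarrow> 'c option) \<Rightarrow> ('c \<Rightarrow> 'a) \<Rightarrow> (nat \<Rightarrow> 'c) \<Rightarrow> bool"
  where
  "enumerates \<sigma> S T pr co l e \<longleftrightarrow> T = e ` word_dom \<sigma> \<and>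
     (\<forall>k. {..<k} \<subseteq> word_dom \<sigma> \<longrightarrow> lin (link S pr co) (map e [0..<k]) \<and> set (map e [0..<k]) \<subseteq> T \<and>
       map l (map e [0..<k]) = map (word_nth \<sigma>) [0..<k])"

lemma enumerates_cover:
  assumes "enumerates \<sigma> S T pr co l e" "finite X" "X \<subseteq> T"
  shows "\<exists>k. {..<k} \<subseteq> word_dom \<sigma> \<and> X \<subseteq> set (map e [0..<k])"
proof -
  obtain I where I: "I \<subseteq> word_dom \<sigma>" "finite I" "X = e ` I"
    using assms finite_subset_image[of X e "word_dom \<sigma>"] unfolding enumerates_def by blast
  obtain k where "I \<subseteq> {..<k}" "{..<k} \<subseteq> word_dom \<sigma>"
  proof (cases \<sigma>)
    case (Fin ys)
    then show ?thesis using that[of "length ys"] I by simp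
  next
    case (Inf f)
    then show ?thesis using that finite_nat_bounded[OF I(2)] by auto
  qed
  then show ?thesis using I(3) by (intro exI[of _ k]) (auto simp: atLeast0LessThan)
qed

lemma lift_enumerates:
  fixes P :: "('b, 'a) process"
  assumes "is_net N" "gr_process N P" "compatible P \<sigma>"
  shows "\<exists>S T pr co l e. lift P = process_of S T pr co l \<and> occurrence N S T pr co l \<and>
    infinite (- (S \<union> T)) \<and> enumerates \<sigma> S T pr co l e"
proof -
  obtain S T pr co l where P: "P = process_of S T pr co l" and occ: "occurrence N S T pr co l"
    using gr_process_decompose[OF assms(1,2)] by metis
  interpret A: occurrence N S T pr co l by fact
  define S' T' :: "('b + nat) set" where "S' = Inl ` S" and "T' = Inl ` T"
  define pr' co' :: "'b + nat \<Rightarrow> ('b + nat) option" where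
    "pr' x = (case x of Inl p \<Rightarrow> map_option Inl (pr p) | Inr _ \<Rightarrow> None)" and
    "co' x = (case x of Inl p \<Rightarrow> map_option Inl (co p) | Inr _ \<Rightarrow> None)" for x
  define l' where "l' = lab (lift P)"
  interpret R: occurrence_renaming N S T pr co l "Inl :: 'b \<Rightarrow> 'b + nat" S' T' pr' co' l'
    by standard (auto simp: S'_def T'_def pr'_def co'_def l'_def lift_def P)
  have lift_P: "lift P = process_of S' T' pr' co' l'"
  proof -
    have "flow (cnet (lift P)) x y = flow (cnet (process_of S' T' pr' co' l')) x y" for x y
      by (cases x; cases y) (auto simp: lift_def P S'_def pr'_def co'_def)
    moreover have "init (cnet (lift P)) x = init (cnet (process_of S' T' pr' co' l')) x" for x
      by (cases x) (auto simp: lift_def P S'_def pr'_def)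
    ultimately have "flow (cnet (lift P)) = flow (cnet (process_of S' T' pr' co' l'))"
      "init (cnet (lift P)) = init (cnet (process_of S' T' pr' co' l'))" by blast+
    moreover have "places (cnet (lift P)) = S'" "transitions (cnet (lift P)) = T'"
      by (simp_all add: lift_def P S'_def T'_def)
    ultimately show ?thesis
      unfolding l'_def by (simp add: process_of_def lift_def)
  qed
  have "range Inr \<subseteq> - (S' \<union> T')" by (auto simp: S'_def T'_def)
  moreover have "infinite (range (Inr :: nat \<Rightarrow> 'b + nat))"
    by (simp add: finite_image_iff)
  ultimately have inf: "infinite (- (S' \<union> T'))" using finite_subset by blast
  obtain pos where pos: "bij_betw pos T (word_dom \<sigma>)" "\<And>t. t \<in> T \<Longrightarrow> l t = word_nth \<sigma> (pos t)"
    "\<And>t u. t \<in> T \<Longrightarrow> u \<in> T \<Longrightarrow> (t, u) \<in> (arcs (cnet P))\<^sup>+ \<Longrightarrow> pos t < pos u"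
    using assms(3) unfolding compatible_def P by auto
  define e' where "e' = inv_into T pos"
  have e': "e' i \<in> T" "pos (e' i) = i" if "i \<in> word_dom \<sigma>" for i
    using that pos(1) unfolding e'_def bij_betw_def by (auto intro: inv_into_into f_inv_into_f)
  have e'_pos: "e' (pos t) = t" if "t \<in> T" for t
    using that pos(1) unfolding e'_def bij_betw_def by simp
  have img: "T = e' ` word_dom \<sigma>"
  proof (intro equalityI subsetI)
    fix t assume "t \<in> T"
    then have "pos t \<in> word_dom \<sigma>" "t = e' (pos t)" using pos(1) e'_pos by (auto dest: bij_betwE)
    then show "t \<in> e' ` word_dom \<sigma>" by blast
  qed (use e'(1) in blast)
  have lin0: "lin (link S pr co) (map e' [0..<k])" if "{..<k} \<subseteq> word_dom \<sigma>" for k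
    using that
  proof (induction k)
    case 0
    then show ?case by simp
  next
    case (Suc k)
    then have k: "k \<in> word_dom \<sigma>" "{..<k} \<subseteq> word_dom \<sigma>" by auto
    have "e' k \<notin> set (map e' [0..<k])"
    proof
      assume "e' k \<in> set (map e' [0..<k])"
      then obtain i where i: "i < k" "e' k = e' i" by auto
      then have "i = k" using e'(2)[of i] e'(2)[of k] k by (metis lessThan_iff subsetD)
      then show False using i(1) by simp
    qed
    moreover have "t \<in> set (map e' [0..<k])" if tk: "link S pr co t (e' k)" for t
    proof -
      have t: "t \<in> T" "e' k \<in> T" using A.link_in[OF tk] by auto
      then have "pos t < k" using pos(3)[OF t] A.link_arcs[OF tk] e'(2)[OF k(1)] unfolding P by simp
      then have "e' (pos t) \<in> set (map e' [0..<k])" by simp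
      then show ?thesis using e'_pos[OF t(1)] by simp
    qed
    ultimately show ?case using Suc.IH[OF k(2)] by simp
  qed
  define e :: "nat \<Rightarrow> 'b + nat" where "e = Inl \<circ> e'"
  have "enumerates \<sigma> S' T' pr' co' l' e"
    unfolding enumerates_def
  proof (intro conjI allI impI)
    show "T' = e ` word_dom \<sigma>" unfolding T'_def e_def using img by (metis image_comp)
    fix k assume k: "{..<k} \<subseteq> word_dom \<sigma>"
    show "lin (link S' pr' co') (map e [0..<k])"
    proof -
      have "lin (link S' pr' co') (map Inl (map e' [0..<k]))"
      proof (rule lin_map[OF lin0[OF k]])
        show "\<exists>t. x = Inl t \<and> link S pr co t u" if xu: "link S' pr' co' x (Inl u)" for x u
        proof -
          obtain p where p: "p \<in> S" "pr' (Inl p) = Some x" "co' (Inl p) = Some (Inl u)"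
            using xu unfolding link_def S'_def by blast
          then show ?thesis unfolding link_def by (auto simp: pr'_def co'_def)
        qed
      qed simp
      then show ?thesis by (simp add: e_def)
    qed
    show "set (map e [0..<k]) \<subseteq> T'"
      using k e'(1) unfolding T'_def e_def by auto
    have "l' (e i) = word_nth \<sigma> i" if "i < k" for i
    proof -
      have i: "i \<in> word_dom \<sigma>" using that k by auto
      show ?thesis using R.l'[of "e' i"] e'[OF i] pos(2)[of "e' i"] by (simp add: e_def)
    qed
    then show "map l' (map e [0..<k]) = map (word_nth \<sigma>) [0..<k]" by simp
  qed
  with lift_P R.occurrence' inf show ?thesis by blast
qed

theorem theorem2:
  fixes N :: "'a net" and P Q :: "('b, 'a) process" and \<sigma> \<rho> :: "'a word"
  assumes "is_net N"
    and "\<sigma> \<in> FS_inf N" and "\<rho> \<in> FS_inf N"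
    and "gr_process N P" and "gr_process N Q"
    and "\<sigma> \<in> Lin N P" and "\<rho> \<in> Lin N Q"
  shows "sqsub0 N \<sigma> \<rho> \<longleftrightarrow> sqsub1 N P Q"
proof -
  have comp: "compatible P \<sigma>" "compatible Q \<rho>" using assms(6,7) unfolding Lin_def by auto
  obtain S T pr co l e where P: "lift P = process_of S T pr co l" "occurrence N S T pr co l"
    "infinite (- (S \<union> T))" "enumerates \<sigma> S T pr co l e"
    using lift_enumerates[OF assms(1,4) comp(1)] by blast
  obtain SQ TQ prQ coQ lQ eQ where Q: "lift Q = process_of SQ TQ prQ coQ lQ" "occurrence N SQ TQ prQ coQ lQ"
    "enumerates \<rho> SQ TQ prQ coQ lQ eQ"
    using lift_enumerates[OF assms(1,5) comp(2)] by blast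
  interpret P: occurrence N S T pr co l by (rule P(2))
  interpret Q: occurrence N SQ TQ prQ coQ lQ by (rule Q(2))
  show ?thesis
  proof
    assume sub0: "sqsub0 N \<sigma> \<rho>"
    show "sqsub1 N P Q"
      unfolding sqsub1_def
    proof (intro allI impI)
      fix P'' :: "('b + nat, 'a) process"
      assume P'': "finite_gr_process N P'' \<and> process_prefix P'' (lift P)"
      then obtain S2 T2 pr2 co2 l2 where P2: "P'' = process_of S2 T2 pr2 co2 l2" "occurrence N S2 T2 pr2 co2 l2"
        using gr_process_decompose[OF assms(1)] unfolding finite_gr_process_def by metis
      interpret P2: occurrence N S2 T2 pr2 co2 l2 by (rule P2(2))
      have pre2: "process_prefix (process_of S2 T2 pr2 co2 l2) (process_of S T pr co l)"
        using P'' P(1) P2(1) by simp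
      note D = prefix_process_ofD[OF P2(2) P(2) pre2]
      have "finite T2" using P'' P2(1) unfolding finite_gr_process_def by simp
      \<comment> \<open>The transitions of \<open>P''\<close> may skip positions of the word. So
        \<open>P''\<close> is enlarged to the prefix generated by the first \<open>k\<close>
        transitions, whose word is a prefix of \<open>\<sigma>\<close>.\<close>
      then obtain k where k: "{..<k} \<subseteq> word_dom \<sigma>" "T2 \<subseteq> set (map e [0..<k])"
        using enumerates_cover[OF P(4)] D(2) by blast
      define ts where "ts = map e [0..<k]"
      have ts: "lin (link S pr co) ts" "set ts \<subseteq> T" "map l ts = map (word_nth \<sigma>) [0..<k]"
        using P(4) k(1) unfolding enumerates_def ts_def by blast+
      obtain S0 co0 where P0: "occurrence N S0 (set ts) pr co0 l" "lin (link S0 pr co0) ts"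
        "process_prefix (process_of S0 (set ts) pr co0 l) (process_of S T pr co l)"
        "S0 = {p \<in> S. \<forall>t. pr p = Some t \<longrightarrow> t \<in> set ts}"
        using P.restrict[OF ts(1,2)] by blast
      have "S2 \<subseteq> S0"
        using D(1,3) P2.pr_in k(2) unfolding P0(4) ts_def by fastforce
      then have pre20: "process_prefix P'' (process_of S0 (set ts) pr co0 l)"
        using process_prefix_between[OF pre2 P0(3)] k(2) P2(1) unfolding ts_def by simp
      have "map l ts \<in> FS N" using P.FS_lin[OF ts(1,2)] .
      moreover have "prefix_word (map l ts) \<sigma>" unfolding prefix_word_iff using k(1) ts(3) by blast
      ultimately obtain \<sigma>' \<rho>' where w: "\<sigma>' \<in> FS N" "prefix (map l ts) \<sigma>'" "(adj0 N)\<^sup>*\<^sup>* \<sigma>' \<rho>'"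
        "prefix_word \<rho>' \<rho>"
        using sub0 unfolding sqsub0_def by blast
      obtain v where v: "\<sigma>' = map l ts @ v" using w(2) by (auto elim: prefixE)
      have "infinite (- (S0 \<union> set ts))"
      proof -
        have "- (S \<union> T) \<subseteq> - (S0 \<union> set ts)" using P0(4) ts(2) by blast
        then show ?thesis using P(3) finite_subset by blast
      qed
      \<comment> \<open>The letters \<open>v\<close> that \<open>\<sigma>'\<close> adds become fresh
        transitions on top of this prefix.\<close>
      from extend[OF P0(1,2) refl this, of v] w(1) v
      obtain S1 T1 pr1 co1 l1 ts1 where P1: "occurrence N S1 T1 pr1 co1 l1" "lin (link S1 pr1 co1) ts1"
        "set ts1 = T1" "map l1 ts1 = \<sigma>'"
        "process_prefix (process_of S0 (set ts) pr co0 l) (process_of S1 T1 pr1 co1 l1)" by blast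
      interpret P1: occurrence N S1 T1 pr1 co1 l1 by (rule P1(1))
      have pre21: "process_prefix P'' (process_of S1 T1 pr1 co1 l1)"
        using process_prefix_trans[OF pre20 P1(5)] .
      show "\<exists>P' Q'. finite_gr_process N P' \<and> finite_gr_process N Q' \<and> process_prefix P'' P' \<and>
          (equiv1 N)\<^sup>*\<^sup>* P' Q' \<and> process_prefix Q' (lift Q)"
      \<comment> \<open>Without places no \<open>equiv1\<close> step is available. But then
        \<open>P''\<close> is empty and \<open>N\<close> has no initial token, so \<open>P''\<close>
        itself is a prefix of \<open>lift Q\<close> and serves as both witnesses.\<close>
      proof (cases "S1 = {}")
        case True
        then have "S2 = {}" using pre21 P2(1) unfolding process_prefix_def by simp
        moreover have "T2 = {}" using P2.nonempty_pre calculation by blast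
        moreover have "prQ p \<noteq> None" if p: "p \<in> SQ" for p
        proof
          assume "prQ p = None"
          then have "{x \<in> SQ. lQ x = lQ p \<and> prQ x = None} \<noteq> {}" using p by blast
          moreover have "card {x \<in> SQ. lQ x = lQ p \<and> prQ x = None} = 0"
            unfolding Q.init_count'(2) P1.init_count'(2)[symmetric] True by simp
          ultimately show False using card_0_eq[OF Q.init_count'(1)[of "lQ p"]] by blast
        qed
        ultimately have "process_prefix P'' (lift Q)"
          unfolding process_prefix_iff P2(1) Q(1) by (auto simp: fun_eq_iff)
        moreover have "process_prefix P'' P''" unfolding process_prefix_iff by simp
        ultimately show ?thesis using P'' by blast
      next
        case False
        obtain co3 ts3 where P3: "occurrence N S1 T1 pr1 co3 l1" "lin (link S1 pr1 co3) ts3"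
          "set ts3 = T1" "map l1 ts3 = \<rho>'" "(equiv1 N)\<^sup>*\<^sup>* (process_of S1 T1 pr1 co1 l1) (process_of S1 T1 pr1 co3 l1)"
          using equiv1_if_adj0[OF w(3) P1(1-4)] by blast
        obtain m where m: "{..<m} \<subseteq> word_dom \<rho>" "\<rho>' = map (word_nth \<rho>) [0..<m]"
          using w(4) unfolding prefix_word_iff by blast
        define us where "us = map eQ [0..<m]"
        have us: "lin (link SQ prQ coQ) us" "set us \<subseteq> TQ" "map lQ us = \<rho>'"
          using Q(3) m unfolding enumerates_def us_def by blast+
        obtain S4 co4 where P4: "occurrence N S4 (set us) prQ co4 lQ" "lin (link S4 prQ co4) us"
          "process_prefix (process_of S4 (set us) prQ co4 lQ) (process_of SQ TQ prQ coQ lQ)"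
          using Q.restrict[OF us(1,2)] by blast
        \<comment> \<open>Both processes have a linearisation that spells
          \<open>\<rho>'\<close>.\<close>
        have "(equiv1 N)\<^sup>*\<^sup>* (process_of S1 T1 pr1 co3 l1) (process_of S4 (set us) prQ co4 lQ)"
          using equiv1_same_word[OF P3(1) P4(1) P3(2,3) P4(2) refl _ False] P3(4) us(3) by simp
        then have "(equiv1 N)\<^sup>*\<^sup>* (process_of S1 T1 pr1 co1 l1) (process_of S4 (set us) prQ co4 lQ)"
          using P3(5) by (rule rtranclp_trans[rotated])
        moreover have "finite_gr_process N (process_of S1 T1 pr1 co1 l1)"
          using P1.finite_gr_process_of[OF _ P1(2,3)] P1(3) by blast
        moreover have "finite_gr_process N (process_of S4 (set us) prQ co4 lQ)"
          using occurrence.finite_gr_process_of[OF P4(1) _ P4(2)] by blast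
        ultimately show ?thesis using pre21 P4(3) Q(1) by metis
      qed
    qed
  next
    assume sub1: "sqsub1 N P Q"
    show "sqsub0 N \<sigma> \<rho>"
      unfolding sqsub0_def
    proof (intro ballI impI)
      fix \<sigma>'' assume "\<sigma>'' \<in> FS N" "prefix_word \<sigma>'' \<sigma>"
      then obtain k where k: "{..<k} \<subseteq> word_dom \<sigma>" "\<sigma>'' = map (word_nth \<sigma>) [0..<k]"
        unfolding prefix_word_iff by blast
      define ts where "ts = map e [0..<k]"
      have ts: "lin (link S pr co) ts" "set ts \<subseteq> T" "map l ts = \<sigma>''"
        using P(4) k unfolding enumerates_def ts_def by blast+
      obtain S0 co0 where P0: "occurrence N S0 (set ts) pr co0 l" "lin (link S0 pr co0) ts"
        "process_prefix (process_of S0 (set ts) pr co0 l) (process_of S T pr co l)"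
        using P.restrict[OF ts(1,2)] by blast
      have "finite_gr_process N (process_of S0 (set ts) pr co0 l)"
        using occurrence.finite_gr_process_of[OF P0(1) _ P0(2)] by blast
      with sub1 P0(3) obtain P' Q' where PQ: "finite_gr_process N P'" "finite_gr_process N Q'"
        "process_prefix (process_of S0 (set ts) pr co0 l) P'" "(equiv1 N)\<^sup>*\<^sup>* P' Q'" "process_prefix Q' (lift Q)"
        unfolding sqsub1_def P(1) by blast
      obtain S1 T1 pr1 co1 l1 where P1: "P' = process_of S1 T1 pr1 co1 l1" "occurrence N S1 T1 pr1 co1 l1"
        using gr_process_decompose[OF assms(1)] PQ(1) unfolding finite_gr_process_def by metis
      obtain S2 T2 pr2 co2 l2 where Q1: "Q' = process_of S2 T2 pr2 co2 l2" "occurrence N S2 T2 pr2 co2 l2"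
        using gr_process_decompose[OF assms(1)] PQ(2) unfolding finite_gr_process_def by metis
      interpret P1: occurrence N S1 T1 pr1 co1 l1 by (rule P1(2))
      interpret Q1: occurrence N S2 T2 pr2 co2 l2 by (rule Q1(2))
      have gr1: "gr_process N (process_of S1 T1 pr1 co1 l1)" "finite T1"
        using PQ(1) unfolding P1(1) finite_gr_process_def by auto
      note D1 = prefix_process_ofD[OF P0(1) P1(2) PQ(3)[unfolded P1(1)]]
      \<comment> \<open>A prefix contains all causes of its transitions, so \<open>ts\<close> stays
        sorted in \<open>P'\<close> and can be completed there behind its last entry.\<close>
      have "lin (link S1 pr1 co1) ts"
        using prefix_lin[OF P0(1) P1(2) PQ(3)[unfolded P1(1)] P0(2)] by blast
      from lin_extend[OF gr1(2) wf_link[OF P1(2) gr1] _ this D1(2)] P1.link_in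
      obtain vs where vs: "lin (link S1 pr1 co1) (ts @ vs)" "set (ts @ vs) = T1" by blast
      have pre_\<sigma>: "prefix \<sigma>'' (map l1 (ts @ vs))"
      proof -
        have "map l1 ts = map l ts" using D1(5) by simp
        then show ?thesis using ts(3) by simp
      qed
      have "\<exists>us. finite (transitions (cnet Q')) \<and> lin (process_link Q') us \<and> set us = transitions (cnet Q') \<and>
          (adj0 N)\<^sup>*\<^sup>* (map (lab P') (ts @ vs)) (map (lab Q') us)"
        using adj0_equiv1_rtranclp[OF assms(1) PQ(4), of "ts @ vs"] vs gr1(2) process_link_process_of[OF P1(2)]
        unfolding P1(1) by simp
      then obtain us where us: "finite T2" "lin (link S2 pr2 co2) us" "set us = T2"
        "(adj0 N)\<^sup>*\<^sup>* (map l1 (ts @ vs)) (map l2 us)"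
        unfolding P1(1) Q1(1) process_link_process_of[OF Q1(2)] by auto
      have pre2: "process_prefix (process_of S2 T2 pr2 co2 l2) (process_of SQ TQ prQ coQ lQ)"
        using PQ(5) unfolding Q1(1) Q(1) .
      note D2 = prefix_process_ofD[OF Q1(2) Q(2) pre2]
      \<comment> \<open>\<open>Q'\<close> need not spell a prefix of \<open>\<rho>\<close>, so it is
        placed inside the prefix generated by the first \<open>m\<close> transitions of
        \<open>Q\<close>.\<close>
      obtain m where m: "{..<m} \<subseteq> word_dom \<rho>" "T2 \<subseteq> set (map eQ [0..<m])"
        using enumerates_cover[OF Q(3) us(1) D2(2)] by blast
      define ws where "ws = map eQ [0..<m]"
      have ws: "lin (link SQ prQ coQ) ws" "set ws \<subseteq> TQ" "map lQ ws = map (word_nth \<rho>) [0..<m]"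
        using Q(3) m(1) unfolding enumerates_def ws_def by blast+
      obtain S4 co4 where P4: "occurrence N S4 (set ws) prQ co4 lQ" "lin (link S4 prQ co4) ws"
        "process_prefix (process_of S4 (set ws) prQ co4 lQ) (process_of SQ TQ prQ coQ lQ)"
        "S4 = {p \<in> SQ. \<forall>t. prQ p = Some t \<longrightarrow> t \<in> set ws}"
        using Q.restrict[OF ws(1,2)] by blast
      interpret P4: occurrence N S4 "set ws" prQ co4 lQ by (rule P4(1))
      have "S2 \<subseteq> S4"
        using D2(1,3) Q1.pr_in m(2) unfolding P4(4) ws_def by fastforce
      then have pre24: "process_prefix (process_of S2 T2 pr2 co2 l2) (process_of S4 (set ws) prQ co4 lQ)"
        using process_prefix_between[OF pre2 P4(3)] m(2) unfolding ws_def by simp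
      \<comment> \<open>The list \<open>us\<close> of \<open>Q'\<close> is completed by
        \<open>xs\<close>, and the result is rearranged to \<open>ws\<close>, which does spell a
        prefix of \<open>\<rho>\<close>.\<close>
      have "lin (link S4 prQ co4) us" using prefix_lin[OF Q1(2) P4(1) pre24 us(2)] us(3) by blast
      moreover have "wf {(t, u). link S4 prQ co4 t u}" using wf_if_lin[OF P4(2)] P4.link_in by blast
      ultimately obtain xs where xs: "lin (link S4 prQ co4) (us @ xs)" "set (us @ xs) = set ws"
        using lin_extend[of "set ws" "link S4 prQ co4" us] P4.link_in us(3) m(2)
        unfolding ws_def by blast
      have adj4: "(adj0 N)\<^sup>*\<^sup>* (map lQ (us @ xs)) (map lQ ws)"
        using P4.adj0_lin[of "[]" "us @ xs" ws] xs P4(2) by simp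
      have l2: "map lQ us = map l2 us" using D2(5) us(3) by simp
      have FS4: "map lQ (us @ xs) \<in> FS N" using P4.FS_lin[OF xs(1)] xs(2) by blast
      have FSw: "map lQ ws \<in> FS N" using P4.FS_lin[OF P4(2)] by blast
      \<comment> \<open>The labels of \<open>xs\<close> can be fired after \<open>us\<close>, hence
        also after every word connected to it by adjacencies; so they are appended to both ends of
        the chain.\<close>
      have "(adj0 N)\<^sup>*\<^sup>* (map l1 (ts @ vs) @ map lQ xs) (map l2 us @ map lQ xs)"
        using FS4 l2 by (intro adj0_rtranclp_append[OF us(4)]) simp
      then have adj: "(adj0 N)\<^sup>*\<^sup>* (map l1 (ts @ vs) @ map lQ xs) (map lQ ws)"
        using adj4 l2 by (metis map_append rtranclp_trans)
      moreover have "map l1 (ts @ vs) @ map lQ xs \<in> FS N" using FS_if_adj0_rtranclp[OF adj FSw] .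
      moreover have "prefix \<sigma>'' (map l1 (ts @ vs) @ map lQ xs)"
        using pre_\<sigma> by (rule prefix_prefix)
      moreover have "prefix_word (map lQ ws) \<rho>" unfolding prefix_word_iff using m(1) ws(3) by blast
      ultimately show "\<exists>\<sigma>' \<in> FS N. \<exists>\<rho>' \<in> FS N. prefix \<sigma>'' \<sigma>' \<and> (adj0 N)\<^sup>*\<^sup>* \<sigma>' \<rho>' \<and> prefix_word \<rho>' \<rho>"
        using FSw by blast
    qed
  qed
qed

end
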